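(* Let $\mathcal{R}$ be any complete representation and $\mathcal{P}=\textsf{MRes-}\mathcal{R}$. Any valid $\mathcal{P}$-refutation $\pi=(C_1,R_1),\dots,(C_m,R_m)$ of a false QBF $\Phi$ can be converted efficiently (in polynomial time) into an $\textsf{MRes-}\mathcal{T}$ refutation $(C_1,T_1),\dots,(C_m,T_m)$ of $\Phi$.
   Context: QBFs $\Phi=Q.\phi$ are closed prenex CNF with existential variables $X$, universal $U$; $y<_Q x$ means $y$ is in an earlier block; $L_Q(u)$ = existential variables left of $u$. Falsifying $u$-literal of $C\in\phi$: $0$ if $u\in C$, $1$ if $\bar u\in C$, $\ast$ otherwise; existential subclause = existential literals of $C$. A strategy for $u$ is a function from assignments of $L_Q(u)$ to $\{0,1,\ast\}$. $p\simeq q$ for $p,q\in\{0,1,\ast\}$ if $p=\ast$, $q=\ast$ or $p=q$; strategies consistent if pointwise consistent; $H\circ H'$ (for consistent $H,H'$) takes $H(\varepsilon)$ if $\ne\ast$ else $H'(\varepsilon)$; $H\overset{x}{\bowtie}H'$ is $H$ on $x=1$ and $H'$ on $x=0$. A representation is complete if every finite function has at least one representation in it. For a complete representation $\mathcal{R}$, an $\textsf{MRes-}\mathcal{R}$ derivation from $\Phi$ is a sequence of lines $(C_i,\{H^u_i:u\in U\})$, $C_i$ a clause of existential literals, $H^u_i$ strategies given in $\mathcal{R}$, each line either an axiom ($C_i$ the existential subclause of some $C\in\phi$, $H^u_i$ constant equal to the falsifying $u$-literal of $C$) or a resolution step ($a,b<i$, existential $x$, $C_i=res(C_a,C_b,x)$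 where $res(C\vee x,D\vee\bar x,x)=C\vee D$, and for each $u$: $H^u_i=H^u_b\overset{x}{\bowtie}H^u_a$ if $x<_Q u$; $H^u_a\simeq H^u_b$ and $H^u_i=H^u_a\circ H^u_b$ if $u<_Q x$). A refutation ends with the empty clause. The $T$-representation: a $T$-graph is a DAG whose sinks are labelled $0$, $1$ or $\ast$, with two kinds of internal nodes: if-else nodes labelled by an existential variable $x$ with an $x$-edge and an $\bar x$-edge (computing $T'\overset{x}{\bowtie}T''$ of its $x$-child $T'$ and $\bar x$-child $T''$), and $\#$ nodes with two inputs $A,B$ computing their union: $1\#1=1$, $0\#0=0$, $\ast\# c = c\#\ast = c$ for $c\in\{0,1,\ast\}$ (inputs assumed consistent). $\textsf{MRes-}\mathcal{T}$ is $\textsf{MRes-}\mathcal{R}$ with the $T$-representation, where an axiom line uses a single sink labelled with the falsifying $u$-literal, a resolution with $x<_Q u$ creates an if-else node on $x$ with $x$-child $T^u_b$ and $\bar x$-child $T^u_a$, and a resolution with $u<_Q x$ creates a $\#$ node with inputs $T^u_a,T^u_b$. *)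

theory Defs
  imports Main "HOL-Library.FuncSet" "HOL-Computational_Algebra.Polynomial"
begin

section \<open>Quantified Boolean formulas\<close>

type_synonym var = nat

datatype lit = Pos (lvar: var) | Neg (lvar: var)

datatype quant = Exists | Forall

text \<open>Clauses and matrices are finite sets of literals resp. clauses, written as lists so that they
  can be given to a program. Everything below depends on clauses only through \<^term>\<open>set\<close>.\<close>

type_synonym clause = "lit list"

datatype qbf = QBF (blocks: "(quant \<times> var list) list") (matrix: "clause list")

definition ex_vars :: "qbf \<Rightarrow> var list" where
  "ex_vars \<Phi> = concat (map snd (filter (\<lambda>B. fst B = Exists) (blocks \<Phi>)))"

definition univ_vars :: "qbf \<Rightarrow> var list" where
  "univ_vars \<Phi> = concat (map snd (filter (\<lambda>B. fst B = Forall) (blocks \<Phi>)))"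

definition closed_qbf :: "qbf \<Rightarrow> bool" where
  "closed_qbf \<Phi> \<longleftrightarrow> distinct (concat (map snd (blocks \<Phi>))) \<and>
     (\<forall>C\<in>set (matrix \<Phi>). lvar ` set C \<subseteq> set (ex_vars \<Phi>) \<union> set (univ_vars \<Phi>))"

definition earlier :: "qbf \<Rightarrow> var \<Rightarrow> var \<Rightarrow> bool" where
  "earlier \<Phi> y x \<longleftrightarrow> (\<exists>i j. i < j \<and> j < length (blocks \<Phi>) \<and>
     y \<in> set (snd (blocks \<Phi> ! i)) \<and> x \<in> set (snd (blocks \<Phi> ! j)))"

definition left_ex :: "qbf \<Rightarrow> var \<Rightarrow> var set" where
  "left_ex \<Phi> u = {x \<in> set (ex_vars \<Phi>). earlier \<Phi> x u}"

fun sat_lit :: "(var \<Rightarrow> bool) \<Rightarrow> lit \<Rightarrow> bool" where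
  "sat_lit \<sigma> (Pos x) = \<sigma> x"
| "sat_lit \<sigma> (Neg x) = (\<not> \<sigma> x)"

fun eval_prefix :: "(quant \<times> var) list \<Rightarrow> clause list \<Rightarrow> (var \<Rightarrow> bool) \<Rightarrow> bool" where
  "eval_prefix [] \<phi> \<sigma> = (\<forall>C\<in>set \<phi>. \<exists>l\<in>set C. sat_lit \<sigma> l)"
| "eval_prefix ((Exists, x) # Q) \<phi> \<sigma> = (\<exists>b. eval_prefix Q \<phi> (\<sigma>(x := b)))"
| "eval_prefix ((Forall, x) # Q) \<phi> \<sigma> = (\<forall>b. eval_prefix Q \<phi> (\<sigma>(x := b)))"

text \<open>The initial assignment is irrelevant for closed formulas.\<close>

definition true_qbf :: "qbf \<Rightarrow> bool" where
  "true_qbf \<Phi> \<longleftrightarrow>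
     eval_prefix (concat (map (\<lambda>(q, xs). map (Pair q) xs) (blocks \<Phi>))) (matrix \<Phi>) (\<lambda>_. False)"


section \<open>Strategies\<close>

datatype tri = Zero | One | Star

type_synonym assignment = "var \<rightharpoonup> bool"
type_synonym strategy = "assignment \<Rightarrow> tri"

definition assignments :: "var set \<Rightarrow> assignment set" where
  "assignments V = {\<epsilon>. dom \<epsilon> = V}"

text \<open>Functions on the assignments of \<open>V\<close> are extensional, so that equality of functions is the
  equality of the logic.\<close>

definition strategies :: "var set \<Rightarrow> strategy set" where
  "strategies V = assignments V \<rightarrow>\<^sub>E UNIV"

definition const_strategy :: "var set \<Rightarrow> tri \<Rightarrow> strategy" where
  "const_strategy V c = (\<lambda>\<epsilon>\<in>assignments V. c)"

definition consistent_val :: "tri \<Rightarrow> tri \<Rightarrow> bool" where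
  "consistent_val p q \<longleftrightarrow> p = Star \<or> q = Star \<or> p = q"

definition consistent :: "var set \<Rightarrow> strategy \<Rightarrow> strategy \<Rightarrow> bool" where
  "consistent V H H' \<longleftrightarrow> (\<forall>\<epsilon>\<in>assignments V. consistent_val (H \<epsilon>) (H' \<epsilon>))"

definition union_strategy :: "var set \<Rightarrow> strategy \<Rightarrow> strategy \<Rightarrow> strategy" where
  "union_strategy V H H' = (\<lambda>\<epsilon>\<in>assignments V. if H \<epsilon> \<noteq> Star then H \<epsilon> else H' \<epsilon>)"

definition ite_strategy :: "var set \<Rightarrow> var \<Rightarrow> strategy \<Rightarrow> strategy \<Rightarrow> strategy" where
  "ite_strategy V x H H' = (\<lambda>\<epsilon>\<in>assignments V. if \<epsilon> x = Some True then H \<epsilon> else H' \<epsilon>)"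


section \<open>Representations and derivations\<close>

text \<open>\<open>R r V = Some f\<close> means that the description \<open>r\<close> represents the function \<open>f\<close> on the
  assignments of \<open>V\<close>; \<^term>\<open>None\<close> means that \<open>r\<close> does not describe a function of the variables \<open>V\<close>.\<close>

type_synonym 'r representation = "'r \<Rightarrow> var set \<Rightarrow> strategy option"

definition complete_representation :: "'r representation \<Rightarrow> bool" where
  "complete_representation R \<longleftrightarrow>
     (\<forall>r V f. R r V = Some f \<longrightarrow> f \<in> strategies V) \<and>
     (\<forall>V f. finite V \<longrightarrow> f \<in> strategies V \<longrightarrow> (\<exists>r. R r V = Some f))"

text \<open>A derivation carries its justification: \<open>Axiom k\<close> refers to the \<open>k\<close>-th clause of the matrix,
  \<open>Res a b x\<close> to the lines \<open>a\<close>, \<open>b\<close> and the pivot \<open>x\<close> (all counted from 0). Of the family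
  \<^term>\<open>strat\<close> only the values at the universal variables are meaningful.\<close>

datatype just = Axiom nat | Res nat nat var

datatype 'r line = Line (clause: clause) (just: just) (strat: "var \<Rightarrow> 'r")

definition falsifying :: "var \<Rightarrow> clause \<Rightarrow> tri" where
  "falsifying u C = (if Pos u \<in> set C then Zero else if Neg u \<in> set C then One else Star)"

definition is_ex_subclause :: "qbf \<Rightarrow> clause \<Rightarrow> clause \<Rightarrow> bool" where
  "is_ex_subclause \<Phi> C D \<longleftrightarrow> set D = {l \<in> set C. lvar l \<in> set (ex_vars \<Phi>)}"

definition is_resolvent :: "clause \<Rightarrow> clause \<Rightarrow> var \<Rightarrow> clause \<Rightarrow> bool" where
  "is_resolvent C D x E \<longleftrightarrow> Pos x \<in> set C \<and> Neg x \<in> set D \<and>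
     set E = (set C - {Pos x}) \<union> (set D - {Neg x})"

definition line_strategy :: "'r representation \<Rightarrow> qbf \<Rightarrow> 'r line \<Rightarrow> var \<Rightarrow> strategy option" where
  "line_strategy R \<Phi> l u = R (strat l u) (left_ex \<Phi> u)"

definition valid_line :: "'r representation \<Rightarrow> qbf \<Rightarrow> 'r line list \<Rightarrow> nat \<Rightarrow> bool" where
  "valid_line R \<Phi> \<pi> i \<longleftrightarrow>
     lvar ` set (clause (\<pi> ! i)) \<subseteq> set (ex_vars \<Phi>) \<and>
     (case just (\<pi> ! i) of
        Axiom k \<Rightarrow>
          k < length (matrix \<Phi>) \<and> is_ex_subclause \<Phi> (matrix \<Phi> ! k) (clause (\<pi> ! i)) \<and>
          (\<forall>u\<in>set (univ_vars \<Phi>). line_strategy R \<Phi> (\<pi> ! i) u =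
             Some (const_strategy (left_ex \<Phi> u) (falsifying u (matrix \<Phi> ! k))))
      | Res a b x \<Rightarrow>
          a < i \<and> b < i \<and> x \<in> set (ex_vars \<Phi>) \<and>
          is_resolvent (clause (\<pi> ! a)) (clause (\<pi> ! b)) x (clause (\<pi> ! i)) \<and>
          (\<forall>u\<in>set (univ_vars \<Phi>). \<exists>Ha Hb H.
             line_strategy R \<Phi> (\<pi> ! a) u = Some Ha \<and>
             line_strategy R \<Phi> (\<pi> ! b) u = Some Hb \<and>
             line_strategy R \<Phi> (\<pi> ! i) u = Some H \<and>
             (earlier \<Phi> x u \<longrightarrow> H = ite_strategy (left_ex \<Phi> u) x Hb Ha) \<and>
             (earlier \<Phi> u x \<longrightarrow> consistent (left_ex \<Phi> u) Ha Hb \<and>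
                H = union_strategy (left_ex \<Phi> u) Ha Hb)))"

definition mres_derivation :: "'r representation \<Rightarrow> qbf \<Rightarrow> 'r line list \<Rightarrow> bool" where
  "mres_derivation R \<Phi> \<pi> \<longleftrightarrow> (\<forall>i<length \<pi>. valid_line R \<Phi> \<pi> i)"

definition mres_refutation :: "'r representation \<Rightarrow> qbf \<Rightarrow> 'r line list \<Rightarrow> bool" where
  "mres_refutation R \<Phi> \<pi> \<longleftrightarrow> mres_derivation R \<Phi> \<pi> \<and> \<pi> \<noteq> [] \<and> clause (last \<pi>) = []"


section \<open>The T-representation\<close>

text \<open>A DAG is the list of its nodes in a topological order (children first); nodes are referred to
  by their positions. In \<open>IfElse x p q\<close> the node \<open>p\<close> is the child along the edge for \<open>x = 1\<close>.\<close>

datatype tnode = Sink tri | IfElse var nat nat | Hash nat nat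

type_synonym tdag = "tnode list"

fun children :: "tnode \<Rightarrow> nat set" where
  "children (Sink c) = {}"
| "children (IfElse x p q) = {p, q}"
| "children (Hash p q) = {p, q}"

definition wf_tdag :: "tdag \<Rightarrow> bool" where
  "wf_tdag G \<longleftrightarrow> (\<forall>n<length G. \<forall>p\<in>children (G ! n). p < n)"

text \<open>The function of the variables \<open>V\<close> computed at a node; undefined if a tested variable is not
  in \<open>V\<close> or the inputs of a Hash node are inconsistent.\<close>

function tfun :: "tdag \<Rightarrow> var set \<Rightarrow> nat \<Rightarrow> strategy option" where
  "tfun G V n =
     (if n < length G \<and> (\<forall>p\<in>children (G ! n). p < n) then
        (case G ! n of
           Sink c \<Rightarrow> Some (const_strategy V c)
         | IfElse x p q \<Rightarrow>
             (case (tfun G V p, tfun G V q) of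
                (Some f, Some g) \<Rightarrow> if x \<in> V then Some (ite_strategy V x f g) else None
              | _ \<Rightarrow> None)
         | Hash p q \<Rightarrow>
             (case (tfun G V p, tfun G V q) of
                (Some f, Some g) \<Rightarrow>
                  if consistent V f g then Some (union_strategy V f g) else None
              | _ \<Rightarrow> None))
      else None)"
  by pat_completeness auto
termination by (relation "measure (\<lambda>(G, V, n). n)") auto

declare tfun.simps [simp del]

definition T_rep :: "(tdag \<times> nat) representation" where
  "T_rep = (\<lambda>(G, n) V. if wf_tdag G then tfun G V n else None)"

text \<open>All T-graphs of a refutation live in one DAG \<open>G\<close>, so that the T-graph of a line contains
  those of its premises as shared subgraphs; a line only stores the root nodes. Unshared copies
  would be of exponential size.\<close>

type_synonym t_refutation = "tdag \<times> nat line list"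

definition t_nodes :: "qbf \<Rightarrow> t_refutation \<Rightarrow> bool" where
  "t_nodes \<Phi> = (\<lambda>(G, ls). \<forall>i<length ls. \<forall>u\<in>set (univ_vars \<Phi>).
     strat (ls ! i) u < length G \<and>
     (case just (ls ! i) of
        Axiom k \<Rightarrow> G ! strat (ls ! i) u = Sink (falsifying u (matrix \<Phi> ! k))
      | Res a b x \<Rightarrow>
          (earlier \<Phi> x u \<longrightarrow>
             G ! strat (ls ! i) u = IfElse x (strat (ls ! b) u) (strat (ls ! a) u)) \<and>
          (earlier \<Phi> u x \<longrightarrow>
             G ! strat (ls ! i) u = Hash (strat (ls ! a) u) (strat (ls ! b) u))))"

definition mres_T_refutation :: "qbf \<Rightarrow> t_refutation \<Rightarrow> bool" where
  "mres_T_refutation \<Phi> \<tau> \<longleftrightarrow> wf_tdag (fst \<tau>) \<and>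
     mres_refutation T_rep \<Phi> (map (map_line (Pair (fst \<tau>))) (snd \<tau>)) \<and> t_nodes \<Phi> \<tau>"


section \<open>Polynomial time\<close>

text \<open>Programs of the WHILE language over binary trees, as in N. D. Jones, Computability and
  Complexity. The cost of an expression includes the sizes of the trees it reads and builds, so
  unlike with unit-cost sharing the cost of a run bounds the size of every intermediate value, and
  the running times agree with those of Turing machines up to a polynomial.\<close>

datatype dtree = Leaf | Node dtree dtree

fun dsize :: "dtree \<Rightarrow> nat" where
  "dsize Leaf = 1"
| "dsize (Node a b) = Suc (dsize a + dsize b)"

datatype expr = VarE nat | NilE | ConsE expr expr | HdE expr | TlE expr | EqE expr expr

type_synonym state = "nat \<Rightarrow> dtree"

fun hd_tree :: "dtree \<Rightarrow> dtree" where
  "hd_tree Leaf = Leaf"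
| "hd_tree (Node a b) = a"

fun tl_tree :: "dtree \<Rightarrow> dtree" where
  "tl_tree Leaf = Leaf"
| "tl_tree (Node a b) = b"

definition enc_bool :: "bool \<Rightarrow> dtree" where
  "enc_bool b = (if b then Node Leaf Leaf else Leaf)"

fun val :: "expr \<Rightarrow> state \<Rightarrow> dtree" where
  "val (VarE x) s = s x"
| "val NilE s = Leaf"
| "val (ConsE e f) s = Node (val e s) (val f s)"
| "val (HdE e) s = hd_tree (val e s)"
| "val (TlE e) s = tl_tree (val e s)"
| "val (EqE e f) s = enc_bool (val e s = val f s)"

fun cost :: "expr \<Rightarrow> state \<Rightarrow> nat" where
  "cost (VarE x) s = dsize (s x)"
| "cost NilE s = 1"
| "cost (ConsE e f) s = Suc (cost e s + cost f s)"
| "cost (HdE e) s = Suc (cost e s)"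
| "cost (TlE e) s = Suc (cost e s)"
| "cost (EqE e f) s = Suc (cost e s + cost f s)"

datatype com = Skip | Assign nat expr | Seq com com | Cond expr com com | While expr com

text \<open>\<open>exec c s t s'\<close>: the program \<open>c\<close> started in \<open>s\<close> halts in \<open>s'\<close> after time \<open>t\<close>. A guard
  holds if its value is not \<^term>\<open>Leaf\<close>.\<close>

inductive exec :: "com \<Rightarrow> state \<Rightarrow> nat \<Rightarrow> state \<Rightarrow> bool" where
  Skip: "exec Skip s 1 s"
| Assign: "exec (Assign x e) s (Suc (cost e s)) (s(x := val e s))"
| Seq: "exec c s t s' \<Longrightarrow> exec d s' t' s'' \<Longrightarrow> exec (Seq c d) s (Suc (t + t')) s''"
| CondTrue: "val e s \<noteq> Leaf \<Longrightarrow> exec c s t s' \<Longrightarrow> exec (Cond e c d) s (Suc (cost e s + t)) s'"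
| CondFalse: "val e s = Leaf \<Longrightarrow> exec d s t s' \<Longrightarrow> exec (Cond e c d) s (Suc (cost e s + t)) s'"
| WhileFalse: "val e s = Leaf \<Longrightarrow> exec (While e c) s (Suc (cost e s)) s"
| WhileTrue: "val e s \<noteq> Leaf \<Longrightarrow> exec c s t s' \<Longrightarrow> exec (While e c) s' t' s'' \<Longrightarrow>
    exec (While e c) s (Suc (cost e s + t + t')) s''"

inductive_cases exec_elims:
  "exec Skip s t s'" "exec (Assign x e) s t s'" "exec (Seq c d) s t s'"
  "exec (Cond e c d) s t s'" "exec (While e c) s t s'"

lemma exec_deterministic:
  "exec c s t s' \<Longrightarrow> exec c s u s'' \<Longrightarrow> u = t \<and> s'' = s'"
proof (induction arbitrary: u s'' rule: exec.induct)
  case (Seq c s t s' d t' s1)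
  from Seq.prems show ?case by (rule exec_elims(3)) (use Seq.IH in blast)
next
  case (WhileTrue e s c t s' t' s1)
  from WhileTrue.prems show ?case
    by (rule exec_elims(5)) (use WhileTrue.hyps WhileTrue.IH in blast)+
next
  case (WhileFalse e s c)
  from WhileFalse.prems show ?case by (rule exec_elims(5)) (use WhileFalse.hyps in auto)
next
  case (CondTrue e s c t s' d)
  from CondTrue.prems show ?case
    by (rule exec_elims(4)) (use CondTrue.hyps CondTrue.IH in blast)+
next
  case (CondFalse e s d t s' c)
  from CondFalse.prems show ?case
    by (rule exec_elims(4)) (use CondFalse.hyps CondFalse.IH in blast)+
qed (auto elim: exec_elims(1,2))

definition input_state :: "dtree \<Rightarrow> state" where
  "input_state d = (\<lambda>_. Leaf)(0 := d)"

text \<open>\<open>f\<close> is computed on the (promised) instances \<open>I\<close>, presented by \<open>enc\<close>; input and output are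
  held in variable 0.\<close>

definition poly_time_on :: "'i set \<Rightarrow> ('i \<Rightarrow> dtree) \<Rightarrow> ('i \<Rightarrow> dtree) \<Rightarrow> bool" where
  "poly_time_on I enc f \<longleftrightarrow> (\<exists>(c :: com) (p :: nat poly). \<forall>i\<in>I. \<exists>t s.
     exec c (input_state (enc i)) t s \<and> s 0 = f i \<and> t \<le> poly p (dsize (enc i)))"


section \<open>Encodings\<close>

fun enc_list :: "('a \<Rightarrow> dtree) \<Rightarrow> 'a list \<Rightarrow> dtree" where
  "enc_list f [] = Leaf"
| "enc_list f (x # xs) = Node (f x) (enc_list f xs)"

text \<open>Binary, least significant bit first, without leading zeros.\<close>

fun enc_nat :: "nat \<Rightarrow> dtree" where
  "enc_nat n = (if n = 0 then Leaf else Node (enc_bool (odd n)) (enc_nat (n div 2)))"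

declare enc_nat.simps [simp del]

fun enc_lit :: "lit \<Rightarrow> dtree" where
  "enc_lit (Pos x) = Node (enc_bool True) (enc_nat x)"
| "enc_lit (Neg x) = Node (enc_bool False) (enc_nat x)"

definition enc_clause :: "clause \<Rightarrow> dtree" where
  "enc_clause = enc_list enc_lit"

definition enc_qbf :: "qbf \<Rightarrow> dtree" where
  "enc_qbf \<Phi> = Node
     (enc_list (\<lambda>(q, xs). Node (enc_bool (q = Exists)) (enc_list enc_nat xs)) (blocks \<Phi>))
     (enc_list enc_clause (matrix \<Phi>))"

fun enc_just :: "just \<Rightarrow> dtree" where
  "enc_just (Axiom k) = Node (enc_bool False) (enc_nat k)"
| "enc_just (Res a b x) = Node (enc_bool True) (Node (enc_nat a) (Node (enc_nat b) (enc_nat x)))"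

definition enc_line :: "('r \<Rightarrow> dtree) \<Rightarrow> qbf \<Rightarrow> 'r line \<Rightarrow> dtree" where
  "enc_line enc \<Phi> l = Node (enc_clause (clause l)) (Node (enc_just (just l))
     (enc_list (\<lambda>u. enc (strat l u)) (univ_vars \<Phi>)))"

fun enc_tri :: "tri \<Rightarrow> dtree" where
  "enc_tri Zero = enc_nat 0"
| "enc_tri One = enc_nat 1"
| "enc_tri Star = enc_nat 2"

fun enc_tnode :: "tnode \<Rightarrow> dtree" where
  "enc_tnode (Sink c) = Node (enc_nat 0) (enc_tri c)"
| "enc_tnode (IfElse x p q) = Node (enc_nat 1) (Node (enc_nat x) (Node (enc_nat p) (enc_nat q)))"
| "enc_tnode (Hash p q) = Node (enc_nat 2) (Node (enc_nat p) (enc_nat q))"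

definition enc_instance :: "qbf \<times> bool list line list \<Rightarrow> dtree" where
  "enc_instance = (\<lambda>(\<Phi>, \<pi>). Node (enc_qbf \<Phi>)
     (enc_list (enc_line (enc_list enc_bool) \<Phi>) \<pi>))"

definition enc_T_refutation :: "qbf \<Rightarrow> t_refutation \<Rightarrow> dtree" where
  "enc_T_refutation \<Phi> = (\<lambda>(G, ls). Node (enc_list enc_tnode G)
     (enc_list (enc_line enc_nat \<Phi>) ls))"

end

theory Submission imports Defs begin

text \<open>Replacing every strategy by the T-graph node that its derivation step prescribes preserves the
  computed functions line by line, so the consistency checks of the given refutation carry over and
  the representations occurring in it need never be read. All nodes are placed in one DAG: the node
  of line \<open>i\<close> and universal variable \<open>u\<close> sits at the position of \<open>(i, u)\<close> in the lexicographic
  enumeration of all such pairs, which makes children precede parents.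

  The running time is obtained by composing closure properties: the functions computable in
  polynomial time from an encoding are closed under pairing, case distinction, equality tests and
  folds whose intermediate results stay polynomially bounded, and the conversion is built from
  these.\<close>

section \<open>Polynomial-time computability relative to an encoding\<close>

text \<open>The time bound is proved for every pair of a formula and a list of lines, because
  \<open>polytime\<close> carries no promise; only correctness uses that the input is a refutation.
  Hence all lookups are total, with defaults coded by \<open>Leaf\<close>, the value of
  \<open>hd_tree\<close> and \<open>tl_tree\<close> on \<open>Leaf\<close>. The obstacle is the
  poverty of the programs: trees offer only heads, tails and equality, so any arithmetic would have
  to be programmed and analysed. The construction therefore only increments binary numbers and tests
  them for equality. The node of \<open>(i, u)\<close> is found by searching a table of keys instead
  of computing an index, and the relative order of \<open>x\<close> and \<open>u\<close> is read off
  by filtering the prefix for these two variables. Division of node numbers appears only in the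
  correctness proof, where it recovers the line.\<close>

lemma poly_nat_mono: "m \<le> n \<Longrightarrow> poly (p :: nat poly) m \<le> poly p n"
proof (induction p)
  case (pCons a p)
  then show ?case by (auto intro!: mult_le_mono)
qed simp

lemma dsize_pos: "0 < dsize d"
  by (cases d) auto

lemma exec_Assign: "val e s = v \<Longrightarrow> Suc (cost e s) = t \<Longrightarrow> exec (Assign x e) s t (s(x := v))"
  using exec.Assign by blast

text \<open>Holds because \<open>cost\<close> charges a variable for its whole tree. With unit-cost
  variables, repeated \<open>ConsE\<close> could double a tree in constant time.\<close>

lemma dsize_val_le_cost: "dsize (val e s) \<le> cost e s"
proof (induction e)
  case (HdE e)
  then show ?case by (cases "val e s") auto
next
  case (TlE e)
  then show ?case by (cases "val e s") auto
next
  case (EqE e f)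
  then show ?case
    using dsize_pos[of "val e s"] dsize_pos[of "val f s"] by (auto simp: enc_bool_def)
qed auto

lemma exec_dsize_le: "exec c s t s' \<Longrightarrow> dsize (s' x) \<le> dsize (s x) + t"
proof (induction rule: exec.induct)
  case (Assign y e s)
  then show ?case using dsize_val_le_cost[of e s] by simp
qed auto

text \<open>Programs may not rely on the contents of the variables other than 0, and there are cofinitely
  many variables that they leave alone. This makes programs composable without renaming.\<close>

definition computes :: "com \<Rightarrow> nat \<Rightarrow> nat poly \<Rightarrow> ('i \<Rightarrow> dtree) \<Rightarrow> ('i \<Rightarrow> dtree) \<Rightarrow> bool" where
  "computes c N p e f \<longleftrightarrow> (\<forall>i s. s 0 = e i \<longrightarrow>
     (\<exists>t s'. exec c s t s' \<and> s' 0 = f i \<and> (\<forall>x\<ge>N. s' x = s x) \<and> t \<le> poly p (dsize (e i))))"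

definition polytime :: "('i \<Rightarrow> dtree) \<Rightarrow> ('i \<Rightarrow> dtree) \<Rightarrow> bool" where
  "polytime e f \<longleftrightarrow> (\<exists>c N p. computes c N p e f)"

lemma polytimeI:
  assumes "\<And>i s. s 0 = e i \<Longrightarrow>
    \<exists>t s'. exec c s t s' \<and> s' 0 = f i \<and> (\<forall>x\<ge>N. s' x = s x) \<and> t \<le> poly p (dsize (e i))"
  shows "polytime e f"
  using assms unfolding polytime_def computes_def by blast

lemma polytimeE:
  assumes "polytime e f"
  obtains c N p where "computes c N p e f"
  using assms unfolding polytime_def by blast

lemma computesE:
  assumes "computes c N p e f" "s 0 = e i"
  obtains t s' where "exec c s t s'" "s' 0 = f i" "\<forall>x\<ge>N. s' x = s x" "t \<le> poly p (dsize (e i))"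
  using assms unfolding computes_def by blast

lemma polytime_imp_poly_time_on:
  assumes "polytime e f"
  shows "poly_time_on I e f"
proof -
  obtain c N p where c: "computes c N p e f"
    using assms by (rule polytimeE)
  have "\<exists>t s. exec c (input_state (e i)) t s \<and> s 0 = f i \<and> t \<le> poly p (dsize (e i))" for i
    by (rule computesE[OF c, of "input_state (e i)" i]) (auto simp: input_state_def)
  then show ?thesis unfolding poly_time_on_def by blast
qed

text \<open>Variable 0 starts with \<open>e i\<close> and grows by at most the running time, which
  gives \<open>[:0, 1:] + p\<close>. Whatever runs on \<open>f i\<close> afterwards can thus be
  timed in terms of the original input.\<close>

lemma polytime_dsize:
  assumes "polytime e f"
  shows "\<exists>p :: nat poly. \<forall>i. dsize (f i) \<le> poly p (dsize (e i))"
proof -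
  obtain c N p where c: "computes c N p e f"
    using assms by (rule polytimeE)
  have "dsize (f i) \<le> poly ([:0, 1:] + p) (dsize (e i))" for i
  proof -
    obtain t s' where "exec c (\<lambda>_. e i) t s'" "s' 0 = f i" "t \<le> poly p (dsize (e i))"
      by (rule computesE[OF c, of "\<lambda>_. e i"]) auto
    then show ?thesis using exec_dsize_le[of c "\<lambda>_. e i" t s' 0] by simp
  qed
  then show ?thesis by blast
qed

section \<open>Composition, pairing and branching of programs\<close>

lemma polytime_refl: "polytime e e"
  by (rule polytimeI[where c = Skip and N = 0 and p = "[:1:]"]) (use exec.Skip in fastforce)

lemma polytime_trans:
  assumes "polytime e f" "polytime f g"
  shows "polytime e g"
proof -
  obtain c N p where c: "computes c N p e f"
    using assms(1) by (rule polytimeE)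
  obtain d M q where d: "computes d M q f g"
    using assms(2) by (rule polytimeE)
  obtain r :: "nat poly" where r: "\<And>i. dsize (f i) \<le> poly r (dsize (e i))"
    using polytime_dsize[OF assms(1)] by blast
  show ?thesis
  \<comment> \<open>The second program is timed in the size of \<open>f i\<close>, hence
    \<open>pcompose q r\<close>. It starts with the leftovers of the first in its work variables,
    which \<open>computes\<close> permits.\<close>
  proof (rule polytimeI[where c = "Seq c d" and N = "max N M" and p = "[:1:] + p + pcompose q r"])
    fix i and s :: state assume "s 0 = e i"
    then obtain t s' where 1: "exec c s t s'" "s' 0 = f i" "\<forall>x\<ge>N. s' x = s x"
      "t \<le> poly p (dsize (e i))"
      by (rule computesE[OF c])
    then obtain t' s'' where 2: "exec d s' t' s''" "s'' 0 = g i" "\<forall>x\<ge>M. s'' x = s' x"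
      "t' \<le> poly q (dsize (f i))"
      using computesE[OF d] by metis
    have "t' \<le> poly q (poly r (dsize (e i)))"
      using 2(4) poly_nat_mono[OF r[of i], of q] by linarith
    then show "\<exists>t s'. exec (Seq c d) s t s' \<and> s' 0 = g i \<and> (\<forall>x\<ge>max N M. s' x = s x) \<and>
        t \<le> poly ([:1:] + p + pcompose q r) (dsize (e i))"
      using exec.Seq[OF 1(1) 2(1)] 1 2 by - (intro exI conjI, assumption, auto simp: poly_pcompose)
  qed
qed

lemma polytime_reindex: "polytime e f \<Longrightarrow> polytime (\<lambda>j. e (h j)) (\<lambda>j. f (h j))"
  unfolding polytime_def computes_def by blast

text \<open>Lets a program written for a standalone input run on a component \<open>h i\<close> of a
  larger instance.\<close>

lemma polytime_comp:
  assumes "polytime e' f" "polytime e (\<lambda>i. e' (h i))"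
  shows "polytime e (\<lambda>i. f (h i))"
  using assms(2) polytime_reindex[OF assms(1)] by (rule polytime_trans)

lemma polytime_val:
  assumes "\<And>i s. s 0 = e i \<Longrightarrow> val x s = f i \<and> Suc (cost x s) \<le> poly p (dsize (e i))"
  shows "polytime e f"
proof (rule polytimeI[where c = "Assign 0 x" and N = 1 and p = p])
  fix i and s :: state assume "s 0 = e i"
  with assms[of s i] exec.Assign[of 0 x s]
  show "\<exists>t s'. exec (Assign 0 x) s t s' \<and> s' 0 = f i \<and> (\<forall>x\<ge>1. s' x = s x) \<and>
      t \<le> poly p (dsize (e i))"
    by - (intro exI conjI, assumption, auto)
qed

lemma polytime_hd: "polytime e f \<Longrightarrow> polytime e (\<lambda>i. hd_tree (f i))"
  by (rule polytime_comp[where e' = "\<lambda>d. d"],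
      rule polytime_val[where x = "HdE (VarE 0)" and p = "[:2, 1:]"]) auto

lemma polytime_tl: "polytime e f \<Longrightarrow> polytime e (\<lambda>i. tl_tree (f i))"
  by (rule polytime_comp[where e' = "\<lambda>d. d"],
      rule polytime_val[where x = "TlE (VarE 0)" and p = "[:2, 1:]"]) auto

lemma polytime_Leaf: "polytime e (\<lambda>_. Leaf)"
  by (rule polytime_val[where x = NilE and p = "[:2:]"]) auto

lemma polytime_Node:
  assumes "polytime e f" "polytime e g"
  shows "polytime e (\<lambda>i. Node (f i) (g i))"
proof -
  obtain c N p where c: "computes c N p e f"
    using assms(1) by (rule polytimeE)
  obtain d M q where d: "computes d M q e g"
    using assms(2) by (rule polytimeE)
  obtain r r' :: "nat poly" where r: "\<And>i. dsize (f i) \<le> poly r (dsize (e i))"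
    and r': "\<And>i. dsize (g i) \<le> poly r' (dsize (e i))"
    using polytime_dsize[OF assms(1)] polytime_dsize[OF assms(2)] by blast
  \<comment> \<open>Variables \<open>K\<close> and \<open>Suc K\<close> keep the input and the first
    result. They lie above everything \<open>c\<close> and \<open>d\<close> may change, and the
    outer \<open>Suc\<close> keeps \<open>K\<close> apart from variable 0.\<close>
  define K where "K = Suc (N + M)"
  let ?c = "Seq (Assign K (VarE 0)) (Seq c (Seq (Assign (Suc K) (VarE 0))
    (Seq (Assign 0 (VarE K)) (Seq d (Assign 0 (ConsE (VarE (Suc K)) (VarE 0)))))))"
  \<comment> \<open>The input is copied twice, the first result is copied once and read once more,
    and the second result is read once.\<close>
  let ?p = "[:10, 2:] + p + q + 2 * r + r'"
  show ?thesis
  proof (rule polytimeI[where c = ?c and N = "K + 2" and p = ?p])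
    fix i and s :: state assume s: "s 0 = e i"
    obtain t1 s1 where 1: "exec c (s(K := e i)) t1 s1" "s1 0 = f i"
      "\<forall>x\<ge>N. s1 x = (s(K := e i)) x" "t1 \<le> poly p (dsize (e i))"
      by (rule computesE[OF c, of "s(K := e i)" i]) (use s in \<open>auto simp: K_def\<close>)
    obtain t2 s2 where 2: "exec d (s1(Suc K := f i, 0 := e i)) t2 s2" "s2 0 = g i"
      "\<forall>x\<ge>M. s2 x = (s1(Suc K := f i, 0 := e i)) x" "t2 \<le> poly q (dsize (e i))"
      by (rule computesE[OF d, of "s1(Suc K := f i, 0 := e i)" i]) auto
    have a: "exec (Assign K (VarE 0)) s (Suc (dsize (e i))) (s(K := e i))"
      using exec.Assign[of K "VarE 0" s] s by simp
    have b: "exec (Assign (Suc K) (VarE 0)) s1 (Suc (dsize (f i))) (s1(Suc K := f i))"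
      using exec.Assign[of "Suc K" "VarE 0" s1] 1 by simp
    have "(s1(Suc K := f i)) K = e i" using 1(3) by (simp add: K_def)
    then have c: "exec (Assign 0 (VarE K)) (s1(Suc K := f i)) (Suc (dsize (e i)))
        (s1(Suc K := f i, 0 := e i))"
      using exec.Assign[of 0 "VarE K" "s1(Suc K := f i)"] by simp
    have "s2 (Suc K) = f i" using 2(3) by (simp add: K_def)
    then have d: "exec (Assign 0 (ConsE (VarE (Suc K)) (VarE 0))) s2
        (2 + dsize (f i) + dsize (g i)) (s2(0 := Node (f i) (g i)))"
      using exec.Assign[of 0 "ConsE (VarE (Suc K)) (VarE 0)" s2] 2 by simp
    show "\<exists>t s'. exec ?c s t s' \<and> s' 0 = Node (f i) (g i) \<and> (\<forall>x\<ge>K + 2. s' x = s x) \<and>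
        t \<le> poly ?p (dsize (e i))"
      using exec.Seq[OF a exec.Seq[OF 1(1) exec.Seq[OF b exec.Seq[OF c exec.Seq[OF 2(1) d]]]]]
        1(3,4) 2(3,4) r[of i] r'[of i]
      by - (intro exI conjI, assumption, auto simp: K_def)
  qed
qed

lemma polytime_eq_tree:
  assumes "polytime e f" "polytime e g"
  shows "polytime e (\<lambda>i. enc_bool (f i = g i))"
proof -
  have "polytime (\<lambda>(d, d'). Node d d') (\<lambda>(d, d'). enc_bool (d = d'))"
    by (rule polytime_val[where x = "EqE (HdE (VarE 0)) (TlE (VarE 0))" and p = "[:4, 2:]"]) auto
  from polytime_comp[OF this, of e "\<lambda>i. (f i, g i)"] show ?thesis
    using polytime_Node[OF assms] by simp
qed

lemma polytime_if:
  assumes "polytime e (\<lambda>i. enc_bool (b i))" "polytime e f" "polytime e g"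
  shows "polytime e (\<lambda>i. if b i then f i else g i)"
proof -
  \<comment> \<open>The condition is evaluated first and stored beside the input, so that the chosen
    branch still finds the input intact.\<close>
  have "polytime e (\<lambda>i. Node (enc_bool (b i)) (e i))"
    using assms(1) polytime_refl by (rule polytime_Node)
  moreover have "polytime (\<lambda>i. Node (enc_bool (b i)) (e i)) (\<lambda>i. if b i then f i else g i)"
  proof -
    obtain c N p where c: "computes c N p e f"
      using assms(2) by (rule polytimeE)
    obtain d M q where d: "computes d M q e g"
      using assms(3) by (rule polytimeE)
    define K where "K = Suc (N + M)"
    let ?c = "Seq (Assign K (HdE (VarE 0))) (Seq (Assign 0 (TlE (VarE 0))) (Cond (VarE K) c d))"
    let ?p = "[:20, 2:] + p + q"
    show ?thesis
    proof (rule polytimeI[where c = ?c and N = "K + 1" and p = ?p])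
      fix i and s :: state assume s: "s 0 = Node (enc_bool (b i)) (e i)"
      let ?s = "s(K := enc_bool (b i), 0 := e i)"
      have 1: "exec (Assign K (HdE (VarE 0))) s (Suc (Suc (dsize (s 0)))) (s(K := enc_bool (b i)))"
        using exec.Assign[of K "HdE (VarE 0)" s] s by simp
      have 2: "exec (Assign 0 (TlE (VarE 0))) (s(K := enc_bool (b i))) (Suc (Suc (dsize (s 0)))) ?s"
        using exec.Assign[of 0 "TlE (VarE 0)" "s(K := enc_bool (b i))"] s by (simp add: K_def)
      have K: "?s K = enc_bool (b i)" by (simp add: K_def)
      let ?d = "dsize (Node (enc_bool (b i)) (e i))"
      have mono: "poly p (dsize (e i)) \<le> poly p ?d" "poly q (dsize (e i)) \<le> poly q ?d"
        by (rule poly_nat_mono, simp)+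
      have size: "dsize (enc_bool (b i)) \<le> 3" by (simp add: enc_bool_def)
      show "\<exists>t s'. exec ?c s t s' \<and> s' 0 = (if b i then f i else g i) \<and>
          (\<forall>x\<ge>K + 1. s' x = s x) \<and> t \<le> poly ?p (dsize (Node (enc_bool (b i)) (e i)))"
      proof (cases "b i")
        case True
        obtain t s' where 3: "exec c ?s t s'" "s' 0 = f i" "\<forall>x\<ge>N. s' x = ?s x"
          "t \<le> poly p (dsize (e i))"
          by (rule computesE[OF c, of ?s i]) auto
        have "exec (Cond (VarE K) c d) ?s (Suc (cost (VarE K) ?s + t)) s'"
          using True K 3(1) by (intro exec.CondTrue) (simp_all add: enc_bool_def)
        from exec.Seq[OF 1 exec.Seq[OF 2 this]] show ?thesis
          using 3 True s mono size K by - (intro exI conjI, assumption, auto simp: K_def)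
      next
        case False
        obtain t s' where 3: "exec d ?s t s'" "s' 0 = g i" "\<forall>x\<ge>M. s' x = ?s x"
          "t \<le> poly q (dsize (e i))"
          by (rule computesE[OF d, of ?s i]) auto
        have "exec (Cond (VarE K) c d) ?s (Suc (cost (VarE K) ?s + t)) s'"
          using False K 3(1) by (intro exec.CondFalse) (simp_all add: enc_bool_def)
        from exec.Seq[OF 1 exec.Seq[OF 2 this]] show ?thesis
          using 3 False s mono size K by - (intro exI conjI, assumption, auto simp: K_def)
      qed
    qed
  qed
  ultimately show ?thesis by (rule polytime_trans)
qed

section \<open>List operations in polynomial time\<close>

lemma dsize_enc_list: "dsize (enc_list f xs) = 1 + (\<Sum>x\<leftarrow>xs. 1 + dsize (f x))"
  by (induction xs) auto

lemma length_le_dsize_enc_list: "length xs \<le> dsize (enc_list f xs)"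
  by (induction xs) auto

lemma dsize_elem_le_enc_list: "x \<in> set xs \<Longrightarrow> dsize (f x) \<le> dsize (enc_list f xs)"
  by (induction xs) auto

lemma dsize_enc_list_le:
  "(\<And>x. x \<in> set xs \<Longrightarrow> dsize (f x) \<le> b) \<Longrightarrow> dsize (enc_list f xs) \<le> 1 + length xs * (1 + b)"
proof (induction xs)
  case (Cons x xs)
  then have "dsize (f x) \<le> b" "dsize (enc_list f xs) \<le> 1 + length xs * (1 + b)" by auto
  then show ?case by simp
qed simp

text \<open>The assumption \<open>size\<close> bounds every intermediate accumulator. It cannot be
  derived from \<open>step\<close>: a step that doubles its accumulator runs in polynomial time, but
  its iteration reaches exponential size. The step also receives the encoded instance, so it can
  refer to outer data.\<close>

lemma polytime_fold:
  fixes q :: "nat poly"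
  assumes xs: "polytime e (\<lambda>i. enc_list (ea i) (xs i))"
    and init: "polytime e (\<lambda>i. es (init i))"
    and step: "polytime (\<lambda>p. Node (e (fst p)) (Node (ea (fst p) (fst (snd p))) (es (snd (snd p)))))
      (\<lambda>p. es (step (fst p) (fst (snd p)) (snd (snd p))))"
    and size: "\<And>i ys zs. xs i = ys @ zs \<Longrightarrow>
      dsize (es (fold (step i) ys (init i))) \<le> poly q (dsize (e i))"
  shows "polytime e (\<lambda>i. es (fold (step i) (xs i) (init i)))"
proof -
  define E where "E i = Node (e i) (Node (enc_list (ea i) (xs i)) (es (init i)))" for i
  obtain c N p where c: "computes c N p
      (\<lambda>p. Node (e (fst p)) (Node (ea (fst p) (fst (snd p))) (es (snd (snd p)))))
      (\<lambda>p. es (step (fst p) (fst (snd p)) (snd (snd p))))"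
    using step by (rule polytimeE)
  \<comment> \<open>Variables \<open>K\<close>, \<open>K + 1\<close> and \<open>K + 2\<close> hold
    the context, the remaining list and the accumulator, out of reach of \<open>c\<close>.\<close>
  define K where "K = Suc N"
  define body where "body = Seq (Assign 0 (ConsE (VarE K) (ConsE (HdE (VarE (K + 1))) (VarE (K + 2)))))
    (Seq c (Seq (Assign (K + 2) (VarE 0)) (Assign (K + 1) (TlE (VarE (K + 1))))))"
  define loop where "loop = While (VarE (K + 1)) body"
  \<comment> \<open>The invariant splits the list into a processed part \<open>ys\<close> and a
    remaining part \<open>zs\<close>. \<open>D\<close> bounds the context and the list,
    \<open>Q\<close> the accumulators, and \<open>B\<close> the time of one round, in which
    \<open>c\<close> reads an input of size at most \<open>2 + 2 * D + Q\<close>. The summand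
    \<open>Suc D\<close> pays for the last, failing guard.\<close>
  have loop: "\<exists>t s'. exec loop s t s' \<and> s' (K + 2) = es (fold (step i) zs (fold (step i) ys (init i)))
      \<and> (\<forall>x\<ge>K + 3. s' x = s x) \<and> t \<le> Suc D + length zs * B"
    if "D = dsize (E i)" "Q = poly q D" "B = 20 + 4 * D + 2 * Q + poly p (2 + 2 * D + Q)"
      "xs i = ys @ zs" "s K = e i" "s (K + 1) = enc_list (ea i) zs"
      "s (K + 2) = es (fold (step i) ys (init i))" for i D Q B ys zs s
    using that
  proof (induction zs arbitrary: ys s)
    case Nil
    have "exec loop s (Suc 1) s"
      using exec.WhileFalse[of "VarE (K + 1)" s body] Nil.prems(6) by (simp add: loop_def)
    moreover have "Suc 1 \<le> Suc D" using dsize_pos[of "E i"] Nil.prems(1) by simp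
    ultimately show ?case using Nil.prems by (intro exI[of _ "Suc 1"] exI[of _ s]) auto
  next
    case (Cons z zs)
    let ?acc = "fold (step i) ys (init i)"
    let ?acc' = "fold (step i) (ys @ [z]) (init i)"
    let ?in = "Node (e i) (Node (ea i z) (es ?acc))"
    have e_le: "dsize (e i) \<le> D" using Cons.prems(1) by (simp add: E_def)
    have list_le: "dsize (enc_list (ea i) (z # zs)) \<le> D"
      using Cons.prems(1,4) by (simp add: E_def dsize_enc_list)
    have Q: "dsize (es ?acc) \<le> Q" "dsize (es ?acc') \<le> Q"
      using size[of i ys "z # zs"] size[of i "ys @ [z]" zs] Cons.prems(2,4)
        poly_nat_mono[OF e_le, of q] by auto
    have 1: "exec (Assign 0 (ConsE (VarE K) (ConsE (HdE (VarE (K + 1))) (VarE (K + 2))))) s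
        (4 + dsize (e i) + dsize (enc_list (ea i) (z # zs)) + dsize (es ?acc)) (s(0 := ?in))"
      by (rule exec_Assign) (use Cons.prems in \<open>simp_all\<close>)
    obtain t s1 where 2: "exec c (s(0 := ?in)) t s1" "s1 0 = es ?acc'"
      "\<forall>x\<ge>N. s1 x = (s(0 := ?in)) x" "t \<le> poly p (dsize ?in)"
      by (rule computesE[OF c, of "s(0 := ?in)" "(i, z, ?acc)"]) auto
    have "dsize ?in \<le> 2 + 2 * D + Q" using e_le list_le Q by simp
    then have t: "t \<le> poly p (2 + 2 * D + Q)"
      using 2(4) poly_nat_mono[of "dsize ?in" "2 + 2 * D + Q" p] by linarith
    let ?s2 = "s1(K + 2 := es ?acc')"
    have 3: "exec (Assign (K + 2) (VarE 0)) s1 (Suc (dsize (es ?acc'))) ?s2"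
      by (rule exec_Assign) (use 2(2) in \<open>simp_all\<close>)
    let ?s3 = "?s2(K + 1 := enc_list (ea i) zs)"
    have s2: "?s2 (K + 1) = enc_list (ea i) (z # zs)"
      using 2(3) Cons.prems(6) by (simp add: K_def)
    have 4: "exec (Assign (K + 1) (TlE (VarE (K + 1)))) ?s2
        (2 + dsize (enc_list (ea i) (z # zs))) ?s3"
      by (rule exec_Assign) (use s2 in \<open>simp_all\<close>)
    note body = exec.Seq[OF 1 exec.Seq[OF 2(1) exec.Seq[OF 3 4]]]
    have xs: "xs i = (ys @ [z]) @ zs" using Cons.prems(4) by simp
    have s3: "?s3 K = e i" "?s3 (K + 1) = enc_list (ea i) zs" "?s3 (K + 2) = es ?acc'"
      using 2(3) Cons.prems(5) by (auto simp: K_def)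
    obtain t' s' where 5: "exec loop ?s3 t' s'" "s' (K + 2) = es (fold (step i) zs ?acc')"
      "\<forall>x\<ge>K + 3. s' x = ?s3 x" "t' \<le> Suc D + length zs * B"
      using Cons.IH[OF Cons.prems(1-3) xs s3] by blast
    have "val (VarE (K + 1)) s \<noteq> Leaf" using Cons.prems(6) by simp
    note run = exec.WhileTrue[OF this body[folded body_def] 5(1)[unfolded loop_def], folded loop_def]
    have s': "s' x = s x" if "K + 3 \<le> x" for x
      using 5(3) 2(3) that by (simp add: K_def)
    show ?case
      by (intro exI conjI, rule run) (use 5(2) s' in simp, use s' in blast, use 5(4) t e_le list_le Q Cons.prems(3,6) in simp)
  qed
  let ?c = "Seq (Assign K (HdE (VarE 0))) (Seq (Assign (K + 1) (HdE (TlE (VarE 0))))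
    (Seq (Assign (K + 2) (TlE (TlE (VarE 0)))) (Seq loop (Assign 0 (VarE (K + 2))))))"
  \<comment> \<open>The bound of one round as a polynomial in \<open>dsize (E i)\<close>; there are
    at most \<open>dsize (E i)\<close> rounds, whence the product in \<open>?p\<close>.\<close>
  let ?B = "[:20, 4:] + 2 * q + pcompose p ([:2, 2:] + q)"
  let ?p = "[:20, 4:] + [:0, 1:] * ?B + q"
  have "polytime E (\<lambda>i. es (fold (step i) (xs i) (init i)))"
  proof (rule polytimeI[where c = ?c and N = "K + 3" and p = ?p])
    fix i and s :: state assume s: "s 0 = E i"
    let ?D = "dsize (E i)"
    let ?s1 = "s(K := e i)"
    let ?s2 = "?s1(K + 1 := enc_list (ea i) (xs i))"
    let ?s3 = "?s2(K + 2 := es (init i))"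
    have 1: "exec (Assign K (HdE (VarE 0))) s (2 + ?D) ?s1"
      by (rule exec_Assign) (use s in \<open>simp_all add: E_def\<close>)
    have 2: "exec (Assign (K + 1) (HdE (TlE (VarE 0)))) ?s1 (3 + ?D) ?s2"
      by (rule exec_Assign) (use s in \<open>simp_all add: E_def K_def\<close>)
    have 3: "exec (Assign (K + 2) (TlE (TlE (VarE 0)))) ?s2 (3 + ?D) ?s3"
      by (rule exec_Assign) (use s in \<open>simp_all add: E_def K_def\<close>)
    have B: "poly ?B ?D = 20 + 4 * ?D + 2 * poly q ?D + poly p (2 + 2 * ?D + poly q ?D)"
      by (simp add: poly_pcompose mult.commute)
    obtain t s' where 4: "exec loop ?s3 t s'" "s' (K + 2) = es (fold (step i) (xs i) (init i))"
      "\<forall>x\<ge>K + 3. s' x = ?s3 x" "t \<le> Suc ?D + length (xs i) * poly ?B ?D"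
      using loop[OF refl refl B, of "[]" "xs i" ?s3] by auto
    have 5: "exec (Assign 0 (VarE (K + 2))) s' (Suc (dsize (s' (K + 2)))) (s'(0 := s' (K + 2)))"
      by (rule exec_Assign) simp_all
    have "length (xs i) \<le> ?D"
      using length_le_dsize_enc_list[of "xs i" "ea i"] by (simp add: E_def)
    then have "length (xs i) * poly ?B ?D \<le> ?D * poly ?B ?D" by (rule mult_le_mono1)
    moreover have "dsize (s' (K + 2)) \<le> poly q ?D"
      using size[of i "xs i" "[]"] 4(2) poly_nat_mono[of "dsize (e i)" ?D q] by (simp add: E_def)
    moreover have "poly ?p ?D = 20 + 4 * ?D + ?D * poly ?B ?D + poly q ?D"
      by (simp add: algebra_simps)
    ultimately have time: "Suc (2 + ?D + Suc (3 + ?D + Suc (3 + ?D + Suc (t + Suc (dsize (s' (K + 2)))))))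
        \<le> poly ?p ?D"
      using 4(4) by linarith
    show "\<exists>t s'. exec ?c s t s' \<and> s' 0 = es (fold (step i) (xs i) (init i)) \<and>
        (\<forall>x\<ge>K + 3. s' x = s x) \<and> t \<le> poly ?p ?D"
      by (intro exI conjI, rule exec.Seq[OF 1 exec.Seq[OF 2 exec.Seq[OF 3 exec.Seq[OF 4(1) 5]]]])
        (use 4 time in auto)
  qed
  moreover have "polytime e E"
    unfolding E_def by (intro polytime_Node polytime_refl xs init)
  ultimately show ?thesis using polytime_trans by blast
qed

text \<open>Under a fold, map or filter the input becomes a pair of the instance and the current
  element. This rule and the next act as variable lookup: facts about the instance are weakened to
  the pair, and the element is its second component.\<close>

lemma polytime_fst_context: "polytime e f \<Longrightarrow> polytime (\<lambda>p. Node (e (fst p)) (h p)) (\<lambda>p. f (fst p))"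
  by (rule polytime_comp[where h = fst], assumption)
    (use polytime_hd[OF polytime_refl, of "\<lambda>p. Node (e (fst p)) (h p)"] in simp)

lemma polytime_snd_context: "polytime (\<lambda>p. Node (h p) (f p)) f"
  using polytime_tl[OF polytime_refl, of "\<lambda>p. Node (h p) (f p)"] by simp

section \<open>Booleans and equality tests\<close>

lemma enc_bool_eq_Leaf: "enc_bool b = Leaf \<longleftrightarrow> \<not> b"
  by (simp add: enc_bool_def)

lemma polytime_not: "polytime e (\<lambda>i. enc_bool (b i)) \<Longrightarrow> polytime e (\<lambda>i. enc_bool (\<not> b i))"
  using polytime_eq_tree[OF _ polytime_Leaf, of e "\<lambda>i. enc_bool (b i)"]
  by (simp add: enc_bool_eq_Leaf)

lemma polytime_False: "polytime e (\<lambda>i. enc_bool False)"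
  using polytime_Leaf by (simp add: enc_bool_def)

lemma polytime_True: "polytime e (\<lambda>i. enc_bool True)"
  using polytime_not[OF polytime_False] by simp

lemma polytime_conj:
  assumes "polytime e (\<lambda>i. enc_bool (b i))" "polytime e (\<lambda>i. enc_bool (c i))"
  shows "polytime e (\<lambda>i. enc_bool (b i \<and> c i))"
proof -
  have "(\<lambda>i. enc_bool (b i \<and> c i)) = (\<lambda>i. if b i then enc_bool (c i) else enc_bool False)" by auto
  then show ?thesis using polytime_if[OF assms polytime_False] by simp
qed

lemma polytime_disj:
  assumes "polytime e (\<lambda>i. enc_bool (b i))" "polytime e (\<lambda>i. enc_bool (c i))"
  shows "polytime e (\<lambda>i. enc_bool (b i \<or> c i))"
  using polytime_not[OF polytime_conj[OF polytime_not polytime_not], OF assms] by simp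

lemma polytime_eq:
  assumes "polytime e (\<lambda>i. g (x i))" "polytime e (\<lambda>i. g (y i))" "inj g"
  shows "polytime e (\<lambda>i. enc_bool (x i = y i))"
  using polytime_eq_tree[OF assms(1,2)] by (simp add: inj_eq[OF assms(3)])

lemma inj_enc_bool: "inj enc_bool"
  by (auto simp: inj_def enc_bool_def)

section \<open>List functions expressed by folds\<close>

lemma polytime_Nil: "polytime e (\<lambda>i. enc_list f [])"
  by (simp add: polytime_Leaf)

lemma polytime_Cons:
  assumes "polytime e (\<lambda>i. f (x i))" "polytime e (\<lambda>i. enc_list f (xs i))"
  shows "polytime e (\<lambda>i. enc_list f (x i # xs i))"
  using polytime_Node[OF assms] by simp

lemma polytime_rev:
  assumes "polytime e (\<lambda>i. enc_list f (xs i))"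
  shows "polytime e (\<lambda>i. enc_list f (rev (xs i)))"
proof -
  have "polytime (enc_list f) (\<lambda>xs. enc_list f (fold Cons xs []))"
  proof (rule polytime_fold[where q = "[:0, 1:]"])
    show "polytime (\<lambda>p. Node (enc_list f (fst p)) (Node (f (fst (snd p))) (enc_list f (snd (snd p)))))
        (\<lambda>p. enc_list f (fst (snd p) # snd (snd p)))"
      using polytime_snd_context[of "\<lambda>p. enc_list f (fst p)"] by simp
  qed (auto simp: polytime_refl polytime_Leaf fold_Cons_rev dsize_enc_list rev_map[symmetric])
  from polytime_comp[OF this assms] show ?thesis by (simp add: fold_Cons_rev)
qed

lemma polytime_append:
  assumes "polytime e (\<lambda>i. enc_list f (xs i))" "polytime e (\<lambda>i. enc_list f (ys i))"
  shows "polytime e (\<lambda>i. enc_list f (xs i @ ys i))"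
proof -
  obtain p q :: "nat poly" where p: "\<And>i. dsize (enc_list f (xs i)) \<le> poly p (dsize (e i))"
    and q: "\<And>i. dsize (enc_list f (ys i)) \<le> poly q (dsize (e i))"
    using polytime_dsize[OF assms(1)] polytime_dsize[OF assms(2)] by blast
  have "polytime e (\<lambda>i. enc_list f (fold Cons (rev (xs i)) (ys i)))"
  proof (rule polytime_fold[where q = "p + q" and ea = "\<lambda>_. f"])
    show "polytime (\<lambda>p. Node (e (fst p)) (Node (f (fst (snd p))) (enc_list f (snd (snd p)))))
        (\<lambda>p. enc_list f (fst (snd p) # snd (snd p)))"
      using polytime_snd_context[of "\<lambda>p. e (fst p)"] by simp
  next
    fix i us vs assume "rev (xs i) = us @ vs"
    then have "xs i = rev vs @ rev us" by (metis rev_append rev_rev_ident)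
    then show "dsize (enc_list f (fold Cons us (ys i))) \<le> poly (p + q) (dsize (e i))"
      using p[of i] q[of i] by (simp add: dsize_enc_list fold_Cons_rev rev_map[symmetric])
  qed (intro polytime_rev assms)+
  then show ?thesis by (simp add: fold_Cons_rev)
qed

lemma polytime_concat:
  fixes f :: "'a \<Rightarrow> dtree"
  assumes "polytime e (\<lambda>i. enc_list (enc_list f) (xss i))"
  shows "polytime e (\<lambda>i. enc_list f (concat (xss i)))"
proof -
  have fold: "fold (\<lambda>xs acc. acc @ xs) xss acc = acc @ concat xss" for xss and acc :: "'a list"
    by (induction xss arbitrary: acc) auto
  have size: "dsize (enc_list f (concat xss)) \<le> dsize (enc_list (enc_list f) xss)" for xss
    by (induction xss) (auto simp: dsize_enc_list)
  have "polytime (enc_list (enc_list f)) (\<lambda>xss. enc_list f (fold (\<lambda>xs acc. acc @ xs) xss []))"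
  proof (rule polytime_fold[where q = "[:0, 1:]"])
    let ?e = "\<lambda>p. Node (enc_list (enc_list f) (fst p))
      (Node (enc_list f (fst (snd p))) (enc_list f (snd (snd p))))"
    have "polytime ?e (\<lambda>p. Node (enc_list f (fst (snd p))) (enc_list f (snd (snd p))))"
      by (rule polytime_snd_context)
    from polytime_hd[OF this] polytime_tl[OF this]
    show "polytime ?e (\<lambda>p. enc_list f (snd (snd p) @ fst (snd p)))"
      by (intro polytime_append) simp_all
  next
    fix xss us vs :: "'a list list" assume "xss = us @ vs"
    then show "dsize (enc_list f (fold (\<lambda>xs acc. acc @ xs) us []))
        \<le> poly [:0, 1:] (dsize (enc_list (enc_list f) xss))"
      using size[of us] by (simp add: fold) (simp add: dsize_enc_list)
  qed (auto simp: polytime_refl polytime_Leaf)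
  from polytime_comp[OF this assms] show ?thesis by (simp add: fold)
qed

text \<open>A fold that conses the images in reverse order, followed by a reversal. The element
  encoding \<open>ea\<close> may vary with the instance, as that of proof lines does.\<close>

lemma polytime_map:
  assumes xs: "polytime e (\<lambda>i. enc_list (ea i) (xs i))"
    and g: "polytime (\<lambda>p. Node (e (fst p)) (ea (fst p) (snd p))) (\<lambda>p. eb (g (fst p) (snd p)))"
  shows "polytime e (\<lambda>i. enc_list eb (map (g i) (xs i)))"
proof -
  have fold: "fold (\<lambda>x acc. g i x # acc) ys acc = rev (map (g i) ys) @ acc" for i ys acc
    by (induction ys arbitrary: acc) auto
  obtain p q :: "nat poly" where p: "\<And>i. dsize (enc_list (ea i) (xs i)) \<le> poly p (dsize (e i))"
    and q: "\<And>j. dsize (eb (g (fst j) (snd j))) \<le> poly q (dsize (Node (e (fst j)) (ea (fst j) (snd j))))"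
    using polytime_dsize[OF xs] polytime_dsize[OF g] by blast
  \<comment> \<open>At most \<open>p\<close> elements, each with an image bounded by
    \<open>q\<close> at the size of the pair of instance and element, which is at most
    \<open>1 + d + p(d)\<close> for an instance of size \<open>d\<close>.\<close>
  let ?r = "[:1:] + p * ([:1:] + pcompose q ([:1, 1:] + p))"
  have "polytime e (\<lambda>i. enc_list eb (fold (\<lambda>x acc. g i x # acc) (xs i) []))"
  proof (rule polytime_fold[where q = ?r and ea = ea])
    let ?e = "\<lambda>p. Node (e (fst p)) (Node (ea (fst p) (fst (snd p))) (enc_list eb (snd (snd p))))"
    have snd: "polytime ?e (\<lambda>p. Node (ea (fst p) (fst (snd p))) (enc_list eb (snd (snd p))))"
      by (rule polytime_snd_context)
    have "polytime ?e (\<lambda>p. Node (e (fst p)) (ea (fst p) (fst (snd p))))"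
      using polytime_hd[OF polytime_refl, of ?e] polytime_hd[OF snd]
      by (intro polytime_Node) simp_all
    then have "polytime ?e (\<lambda>p. eb (g (fst p) (fst (snd p))))"
      using polytime_comp[OF g, of ?e "\<lambda>p. (fst p, fst (snd p))"] by simp
    then show "polytime ?e (\<lambda>p. enc_list eb (g (fst p) (fst (snd p)) # snd (snd p)))"
      using polytime_tl[OF snd] by (intro polytime_Cons) simp_all
  next
    fix i ys zs assume *: "xs i = ys @ zs"
    let ?d = "dsize (e i)"
    have "dsize (eb y) \<le> poly q (1 + ?d + poly p ?d)" if y: "y \<in> set (rev (map (g i) ys))" for y
    proof -
      obtain x where x: "x \<in> set ys" "y = g i x" using y by auto
      then have "dsize (ea i x) \<le> poly p ?d"
        using dsize_elem_le_enc_list[of x "xs i" "ea i"] p[of i] * by simp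
      then have "dsize (Node (e i) (ea i x)) \<le> 1 + ?d + poly p ?d" by simp
      from poly_nat_mono[OF this, of q] show ?thesis using q[of "(i, x)"] x by simp
    qed
    from dsize_enc_list_le[of "rev (map (g i) ys)" eb, OF this]
    have "dsize (enc_list eb (rev (map (g i) ys))) \<le> 1 + length ys * (1 + poly q (1 + ?d + poly p ?d))"
      by simp
    also have "\<dots> \<le> 1 + poly p ?d * (1 + poly q (1 + ?d + poly p ?d))"
      using length_le_dsize_enc_list[of "xs i" "ea i"] p[of i] *
      by (intro add_left_mono mult_le_mono1) simp
    finally show "dsize (enc_list eb (fold (\<lambda>x acc. g i x # acc) ys [])) \<le> poly ?r ?d"
      by (simp add: fold poly_pcompose)
  qed (auto simp: xs polytime_Leaf)
  from polytime_rev[OF this] show ?thesis by (simp add: fold)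
qed

lemma polytime_filter:
  assumes xs: "polytime e (\<lambda>i. enc_list ea (xs i))"
    and P: "polytime (\<lambda>p. Node (e (fst p)) (ea (snd p))) (\<lambda>p. enc_bool (P (fst p) (snd p)))"
  shows "polytime e (\<lambda>i. enc_list ea (filter (P i) (xs i)))"
proof -
  \<comment> \<open>Concatenating lists of length at most one reduces filtering to
    \<open>polytime_map\<close> and \<open>polytime_concat\<close>, with no new loop.\<close>
  have filter: "filter (P i) ys = concat (map (\<lambda>x. if P i x then [x] else []) ys)" for i ys
    by (induction ys) auto
  have "polytime (\<lambda>p. Node (e (fst p)) (ea (snd p)))
      (\<lambda>p. if P (fst p) (snd p) then enc_list ea [snd p] else enc_list ea [])"
    by (intro polytime_if polytime_Cons polytime_Nil P polytime_snd_context)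
  then have "polytime (\<lambda>p. Node (e (fst p)) (ea (snd p)))
      (\<lambda>p. enc_list ea (if P (fst p) (snd p) then [snd p] else []))"
    by (simp add: if_distrib)
  from polytime_concat[OF polytime_map[where ea = "\<lambda>_. ea" and eb = "enc_list ea"
        and g = "\<lambda>i x. if P i x then [x] else []", OF xs this]] show ?thesis by (simp only: filter)
qed

text \<open>Membership means that the list filtered for equality with \<open>x i\<close> is not
  empty, that is, its code is not \<open>Leaf\<close>.\<close>

lemma polytime_mem:
  assumes "polytime e (\<lambda>i. ea (x i))" "polytime e (\<lambda>i. enc_list ea (xs i))" "inj ea"
  shows "polytime e (\<lambda>i. enc_bool (x i \<in> set (xs i)))"
proof -
  have "polytime e (\<lambda>i. enc_list ea (filter (\<lambda>y. y = x i) (xs i)))"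
    using assms
    by (intro polytime_filter polytime_eq[where g = ea] polytime_snd_context
        polytime_fst_context[where f = "\<lambda>i. ea (x i)"])
  then have "polytime e (\<lambda>i. enc_bool (enc_list ea (filter (\<lambda>y. y = x i) (xs i)) \<noteq> Leaf))"
    by (intro polytime_not polytime_eq_tree polytime_Leaf)
  moreover have "enc_list ea (filter (\<lambda>y. y = a) ys) \<noteq> Leaf \<longleftrightarrow> a \<in> set ys" for a ys
    by (induction ys) auto
  ultimately show ?thesis by simp
qed

subsection \<open>Binary numbers and positions\<close>

text \<open>Exhibits \<open>enc_nat\<close> as an \<open>enc_list\<close> of Booleans, so that the
  list rules apply to numbers.\<close>

fun bits :: "nat \<Rightarrow> bool list" where
  "bits n = (if n = 0 then [] else odd n # bits (n div 2))"

declare bits.simps [simp del]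

lemma enc_nat_eq_enc_bits: "enc_nat n = enc_list enc_bool (bits n)"
  by (induction n rule: bits.induct) (subst enc_nat.simps, subst bits.simps, simp)

lemma inj_enc_list: "inj f \<Longrightarrow> inj (enc_list f)"
proof (rule injI)
  fix xs ys assume "inj f" "enc_list f xs = enc_list f ys"
  then show "xs = ys"
  proof (induction xs arbitrary: ys)
    case Nil
    then show ?case by (cases ys) auto
  next
    case (Cons x xs)
    then show ?case by (cases ys) (auto dest: injD)
  qed
qed

lemma bits_inj: "bits m = bits n \<Longrightarrow> m = n"
proof (induction m arbitrary: n rule: bits.induct)
  case (1 m)
  consider "m = 0" "n = 0" | "m = 0" "n \<noteq> 0" | "m \<noteq> 0" "n = 0" | "m \<noteq> 0" "n \<noteq> 0" by blast
  then show ?case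
  proof cases
    case 4
    then have "odd m = odd n" and *: "bits (m div 2) = bits (n div 2)"
      using "1.prems" by (simp_all add: bits.simps[of m] bits.simps[of n])
    then have "m mod 2 = n mod 2" by presburger
    moreover have "m div 2 = n div 2" using 4(1) * by (rule "1.IH")
    ultimately show ?thesis by (metis div_mult_mod_eq)
  qed (use "1.prems" in \<open>simp_all add: bits.simps[of m] bits.simps[of n] bits.simps[of 0]\<close>)
qed

lemma inj_enc_nat: "inj enc_nat"
proof (rule injI)
  fix m n assume "enc_nat m = enc_nat n"
  then have "bits m = bits n"
    unfolding enc_nat_eq_enc_bits by (rule injD[OF inj_enc_list[OF inj_enc_bool]])
  then show "m = n" by (rule bits_inj)
qed

text \<open>A linear bound is enough: it is applied to counters that run through an encoded list,
  whose values are at most the size of that list.\<close>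

lemma dsize_enc_nat_le: "dsize (enc_nat n) \<le> 4 * n + 1"
proof (induction n rule: less_induct)
  case (less n)
  have bool: "dsize (enc_bool b) \<le> 3" for b by (simp add: enc_bool_def)
  consider "n = 0" | "n = 1" | "2 \<le> n" by linarith
  then show ?case
  proof cases
    case 1
    then show ?thesis by (simp add: enc_nat.simps[of 0])
  next
    case 2
    then show ?thesis using bool[of True] by (simp add: enc_nat.simps[of "Suc 0"] enc_nat.simps[of 0])
  next
    case 3
    then have "dsize (enc_nat n) \<le> 4 + dsize (enc_nat (n div 2))"
      using bool[of "odd n"] by (subst enc_nat.simps) simp
    also have "dsize (enc_nat (n div 2)) \<le> 4 * (n div 2) + 1" using 3 by (intro less) simp
    finally show ?thesis using 3 by linarith
  qed
qed

section \<open>Binary successor\<close>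

fun increment :: "bool list \<Rightarrow> bool list" where
  "increment [] = [True]"
| "increment (False # bs) = True # bs"
| "increment (True # bs) = False # increment bs"

lemma bits_Suc: "bits (Suc n) = increment (bits n)"
proof (induction n rule: bits.induct)
  case (1 n)
  consider "n = 0" | "even n" "n \<noteq> 0" | "odd n" "n \<noteq> 0" by fastforce
  then show ?case
  proof cases
    case 1
    then show ?thesis by (simp add: bits.simps[of 0] bits.simps[of "Suc 0"])
  next
    case 2
    then have "Suc n div 2 = n div 2" by presburger
    with 2 show ?thesis by (simp add: bits.simps[of n] bits.simps[of "Suc n"])
  next
    case 3
    then have "Suc n div 2 = Suc (n div 2)" by presburger
    with 3 1 show ?thesis by (simp add: bits.simps[of n] bits.simps[of "Suc n"])
  qed
qed

text \<open>Ripple-carry addition as a fold: the state is the carry with the output bits in reverse,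
  \<open>b \<noteq> c\<close> is the sum bit and \<open>c \<and> b\<close> the next carry. A carry
  left at the end becomes the new most significant bit.\<close>

lemma fold_increment:
  "fold (\<lambda>b (c, acc). (c \<and> b, (b \<noteq> c) # acc)) bs (c, acc) = (c', acc') \<Longrightarrow>
    rev acc' @ (if c' then [True] else []) = rev acc @ (if c then increment bs else bs)"
proof (induction bs arbitrary: c acc)
  case (Cons b bs)
  from Cons.IH[of "c \<and> b" "(b \<noteq> c) # acc"] Cons.prems show ?case by (cases b; cases c) auto
qed auto

lemma polytime_Suc:
  assumes "polytime e (\<lambda>i. enc_nat (n i))"
  shows "polytime e (\<lambda>i. enc_nat (Suc (n i)))"
proof -
  define es where "es = (\<lambda>(c, acc). Node (enc_bool c) (enc_list enc_bool acc))"
  let ?step = "\<lambda>b (c, acc). (c \<and> b, (b \<noteq> c) # acc)"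
  have size: "dsize (es (fold ?step bs (c, acc))) \<le> 20 + 4 * (length bs + length acc)" for bs c acc
  proof (induction bs arbitrary: c acc)
    case Nil
    have "dsize (enc_list enc_bool acc) \<le> 1 + length acc * (1 + 3)"
      by (rule dsize_enc_list_le) (simp add: enc_bool_def)
    then show ?case by (simp add: es_def enc_bool_def)
  next
    case (Cons b bs)
    from Cons.IH[of "c \<and> b" "(b \<noteq> c) # acc"] show ?case by simp
  qed
  \<comment> \<open>The number added is the initial carry \<open>True\<close>.\<close>
  have "polytime (enc_list enc_bool) (\<lambda>bs. es (fold ?step bs (True, [])))"
  proof (rule polytime_fold[where q = "[:20, 4:]"])
    show "polytime (enc_list enc_bool) (\<lambda>i. es (True, []))"
      unfolding es_def by (simp add: polytime_Node polytime_True polytime_Leaf)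
  next
    let ?e = "\<lambda>p. Node (enc_list enc_bool (fst p)) (Node (enc_bool (fst (snd p))) (es (snd (snd p))))"
    have *: "polytime ?e (\<lambda>p. Node (enc_bool (fst (snd p))) (es (snd (snd p))))"
      by (rule polytime_snd_context)
    have b: "polytime ?e (\<lambda>p. enc_bool (fst (snd p)))" using polytime_hd[OF *] by simp
    have s: "polytime ?e (\<lambda>p. es (snd (snd p)))" using polytime_tl[OF *] by simp
    have c: "polytime ?e (\<lambda>p. enc_bool (fst (snd (snd p))))"
      using polytime_hd[OF s] by (simp add: es_def case_prod_beta)
    have acc: "polytime ?e (\<lambda>p. enc_list enc_bool (snd (snd (snd p))))"
      using polytime_tl[OF s] by (simp add: es_def case_prod_beta)
    have "polytime ?e (\<lambda>p. Node (enc_bool (fst (snd (snd p)) \<and> fst (snd p)))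
        (enc_list enc_bool ((fst (snd p) \<noteq> fst (snd (snd p))) # snd (snd (snd p)))))"
      by (intro polytime_Node polytime_Cons polytime_conj polytime_not polytime_eq[where g = enc_bool]
          b c acc inj_enc_bool)
    then show "polytime ?e (\<lambda>p. es (?step (fst (snd p)) (snd (snd p))))"
      by (simp add: es_def case_prod_beta)
  next
    fix bs ys zs :: "bool list" assume "bs = ys @ zs"
    then show "dsize (es (fold ?step ys (True, []))) \<le> poly [:20, 4:] (dsize (enc_list enc_bool bs))"
      using size[of ys True "[]"] length_le_dsize_enc_list[of bs enc_bool] by simp
  qed (rule polytime_refl)
  from polytime_comp[OF this, of e "\<lambda>i. bits (n i)"]
  have *: "polytime e (\<lambda>i. es (fold ?step (bits (n i)) (True, [])))"
    using assms by (simp add: enc_nat_eq_enc_bits)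
  define r where "r i = fold ?step (bits (n i)) (True, [])" for i
  have c: "polytime e (\<lambda>i. enc_bool (fst (r i)))"
    using polytime_hd[OF *] by (simp add: r_def es_def case_prod_beta)
  have acc: "polytime e (\<lambda>i. enc_list enc_bool (rev (snd (r i))))"
    using polytime_tl[OF *] by (intro polytime_rev) (simp add: r_def es_def case_prod_beta)
  have "polytime e (\<lambda>i. if fst (r i) then enc_list enc_bool (rev (snd (r i)) @ [True])
      else enc_list enc_bool (rev (snd (r i))))"
    by (intro polytime_if polytime_append polytime_Cons polytime_Nil polytime_True c acc)
  moreover have "enc_nat (Suc (n i)) = (if fst (r i) then enc_list enc_bool (rev (snd (r i)) @ [True])
      else enc_list enc_bool (rev (snd (r i))))" for i
    using fold_increment[of "bits (n i)" True "[]" "fst (r i)" "snd (r i)"]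
    by (auto simp: r_def enc_nat_eq_enc_bits bits_Suc)
  ultimately show ?thesis by simp
qed

section \<open>Pairs, enumeration and table lookup\<close>

lemma polytime_0: "polytime e (\<lambda>i. enc_nat 0)"
  by (simp add: enc_nat.simps[of 0] polytime_Leaf)

definition enc_pair :: "('a \<Rightarrow> dtree) \<Rightarrow> ('b \<Rightarrow> dtree) \<Rightarrow> 'a \<times> 'b \<Rightarrow> dtree" where
  "enc_pair f g p = Node (f (fst p)) (g (snd p))"

lemma polytime_Pair:
  assumes "polytime e (\<lambda>i. f (x i))" "polytime e (\<lambda>i. g (y i))"
  shows "polytime e (\<lambda>i. enc_pair f g (x i, y i))"
  using polytime_Node[OF assms] by (simp add: enc_pair_def)

lemma polytime_fst: "polytime e (\<lambda>i. enc_pair f g (x i)) \<Longrightarrow> polytime e (\<lambda>i. f (fst (x i)))"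
  using polytime_hd[of e "\<lambda>i. enc_pair f g (x i)"] by (simp add: enc_pair_def)

lemma polytime_snd: "polytime e (\<lambda>i. enc_pair f g (x i)) \<Longrightarrow> polytime e (\<lambda>i. g (snd (x i)))"
  using polytime_tl[of e "\<lambda>i. enc_pair f g (x i)"] by (simp add: enc_pair_def)

lemma inj_enc_pair: "inj f \<Longrightarrow> inj g \<Longrightarrow> inj (enc_pair f g)"
  by (auto simp: inj_def enc_pair_def)

lemma polytime_enumerate:
  assumes "polytime e (\<lambda>i. enc_list f (xs i))"
  shows "polytime e (\<lambda>i. enc_list (enc_pair enc_nat f) (List.enumerate 0 (xs i)))"
proof -
  let ?es = "enc_pair enc_nat (enc_list (enc_pair enc_nat f))"
  let ?step = "\<lambda>x s. (Suc (fst s), (fst s, x) # snd s)"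
  have fold: "fold ?step xs (n, acc) = (n + length xs, rev (List.enumerate n xs) @ acc)"
    for xs :: "'b list" and n acc
    by (induction xs arbitrary: n acc) auto
  \<comment> \<open>Each of at most \<open>d\<close> pairs holds an element of size at most
    \<open>d\<close> and an index below \<open>d\<close>, coded in size at most
    \<open>4 * d + 1\<close>; this makes the bound quadratic.\<close>
  have size: "dsize (?es (length xs, rev (List.enumerate 0 xs))) \<le> 10 + 10 * d + 5 * d * d"
    if d: "dsize (enc_list f xs) \<le> d" for xs d
  proof -
    have len: "length xs \<le> d" using length_le_dsize_enc_list[of xs f] d by simp
    have "dsize (enc_pair enc_nat f p) \<le> 2 + 5 * d" if p: "p \<in> set (rev (List.enumerate 0 xs))" for p
    proof -
      have "fst p < length xs" "snd p \<in> set xs"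
        using p nth_mem[of "fst p" xs] by (simp_all add: in_set_enumerate_eq)
      then show ?thesis
        using len d dsize_enc_nat_le[of "fst p"] dsize_elem_le_enc_list[of "snd p" xs f]
        by (simp add: enc_pair_def)
    qed
    from dsize_enc_list_le[of "rev (List.enumerate 0 xs)" "enc_pair enc_nat f", OF this]
    have "dsize (enc_list (enc_pair enc_nat f) (rev (List.enumerate 0 xs))) \<le> 1 + length xs * (3 + 5 * d)"
      by (simp add: algebra_simps)
    also have "\<dots> \<le> 1 + d * (3 + 5 * d)" using len by simp
    finally show ?thesis
      using dsize_enc_nat_le[of "length xs"] len by (simp add: enc_pair_def algebra_simps)
  qed
  have "polytime (enc_list f) (\<lambda>xs. ?es (fold ?step xs (0, [])))"
  proof (rule polytime_fold[where q = "[:10, 10, 5:]"])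
    show "polytime (enc_list f) (\<lambda>i. ?es (0, []))"
      by (intro polytime_Pair polytime_0 polytime_Nil)
  next
    let ?e = "\<lambda>p. Node (enc_list f (fst p)) (Node (f (fst (snd p))) (?es (snd (snd p))))"
    have *: "polytime ?e (\<lambda>p. Node (f (fst (snd p))) (?es (snd (snd p))))"
      by (rule polytime_snd_context)
    have x: "polytime ?e (\<lambda>p. f (fst (snd p)))" using polytime_hd[OF *] by simp
    have s: "polytime ?e (\<lambda>p. ?es (snd (snd p)))" using polytime_tl[OF *] by simp
    show "polytime ?e (\<lambda>p. ?es (?step (fst (snd p)) (snd (snd p))))"
      by (intro polytime_Pair polytime_Suc polytime_Cons x polytime_fst[OF s] polytime_snd[OF s])
  next
    fix xs ys zs :: "'b list" assume "xs = ys @ zs"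
    then have "dsize (enc_list f ys) \<le> dsize (enc_list f xs)" by (simp add: dsize_enc_list)
    from size[OF this]
    show "dsize (?es (fold ?step ys (0, []))) \<le> poly [:10, 10, 5:] (dsize (enc_list f xs))"
      by (simp add: fold algebra_simps)
  qed (rule polytime_refl)
  from polytime_rev[OF polytime_snd[OF polytime_comp[OF this assms]]]
  show ?thesis by (simp add: fold)
qed

lemma polytime_product:
  assumes "polytime e (\<lambda>i. enc_list f (xs i))" "polytime e (\<lambda>i. enc_list g (ys i))"
  shows "polytime e (\<lambda>i. enc_list (enc_pair f g) (List.product (xs i) (ys i)))"
proof -
  let ?e = "\<lambda>p. Node (e (fst p)) (f (snd p))"
  have "polytime (\<lambda>q. Node (?e (fst q)) (g (snd q))) (\<lambda>q. enc_pair f g (snd (fst q), snd q))"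
    by (intro polytime_Pair polytime_snd_context
        polytime_fst_context[where f = "\<lambda>p. f (snd p)", OF polytime_snd_context])
  from polytime_map[where eb = "enc_pair f g" and ea = "\<lambda>_. g" and g = "\<lambda>p y. (snd p, y)",
      OF polytime_fst_context[OF assms(2)] this]
  have "polytime ?e (\<lambda>p. enc_list (enc_pair f g) (map (Pair (snd p)) (ys (fst p))))" by simp
  from polytime_concat[OF polytime_map[where g = "\<lambda>i x. map (Pair x) (ys i)"
        and eb = "enc_list (enc_pair f g)", OF assms(1) this]]
  show ?thesis by (simp add: product_concat_map)
qed

text \<open>Phrased with \<open>filter\<close> and \<open>List.enumerate\<close> so that the closure
  rules apply directly. The default 0 has code \<open>Leaf\<close>, which is also what taking heads
  in an empty list returns.\<close>

definition position :: "'a list \<Rightarrow> 'a \<Rightarrow> nat" where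
  "position xs x = (case filter (\<lambda>p. snd p = x) (List.enumerate 0 xs) of [] \<Rightarrow> 0 | p # _ \<Rightarrow> fst p)"

lemma position:
  assumes "x \<in> set xs"
  shows "position xs x < length xs" "xs ! position xs x = x"
proof -
  obtain n where "n < length xs" "xs ! n = x" using assms by (auto simp: in_set_conv_nth)
  then have "(n, x) \<in> set (filter (\<lambda>p. snd p = x) (List.enumerate 0 xs))"
    by (simp add: in_set_enumerate_eq)
  then obtain p ps where *: "filter (\<lambda>p. snd p = x) (List.enumerate 0 xs) = p # ps"
    by (cases "filter (\<lambda>p. snd p = x) (List.enumerate 0 xs)") auto
  from arg_cong[OF this, of set] have "p \<in> set (List.enumerate 0 xs)" "snd p = x" by auto
  then show "position xs x < length xs" "xs ! position xs x = x"
    using * by (simp_all add: position_def in_set_enumerate_eq)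
qed

lemma polytime_position:
  assumes "polytime e (\<lambda>i. f (x i))" "polytime e (\<lambda>i. enc_list f (xs i))" "inj f"
  shows "polytime e (\<lambda>i. enc_nat (position (xs i) (x i)))"
proof -
  have "polytime e (\<lambda>i. enc_list (enc_pair enc_nat f)
      (filter (\<lambda>p. snd p = x i) (List.enumerate 0 (xs i))))"
    by (intro polytime_filter polytime_enumerate polytime_eq[where g = f] assms
        polytime_snd[OF polytime_snd_context] polytime_fst_context[where f = "\<lambda>i. f (x i)"])
  from polytime_hd[OF polytime_hd[OF this]] show ?thesis
    unfolding position_def
    by (rule back_subst[of "polytime e"])
      (auto simp: fun_eq_iff enc_pair_def enc_nat.simps[of 0] split: list.split)
qed

lemma filter_fst_enumerate:
  "filter (\<lambda>p. fst p = n) (List.enumerate m xs) =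
    (if m \<le> n \<and> n < m + length xs then [(n, xs ! (n - m))] else [])"
  by (induction xs arbitrary: m) (auto simp: nth_Cons' not_less_eq_eq)

text \<open>The condition on \<open>d\<close> makes the default agree with what the projections
  yield when the filtered enumeration is empty; the empty clause satisfies it.\<close>

lemma polytime_nth_default:
  assumes "polytime e (\<lambda>i. enc_nat (n i))" "polytime e (\<lambda>i. enc_list f (xs i))" "f d = Leaf"
  shows "polytime e (\<lambda>i. f (nth_default d (xs i) (n i)))"
proof -
  have "polytime e (\<lambda>i. enc_list (enc_pair enc_nat f)
      (filter (\<lambda>p. fst p = n i) (List.enumerate 0 (xs i))))"
    by (intro polytime_filter polytime_enumerate polytime_eq[where g = enc_nat] assms inj_enc_nat
        polytime_fst[OF polytime_snd_context] polytime_fst_context[where f = "\<lambda>i. enc_nat (n i)"])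
  from polytime_tl[OF polytime_hd[OF this]] show ?thesis
    by (rule back_subst[of "polytime e"])
      (auto simp: fun_eq_iff enc_pair_def nth_default_def filter_fst_enumerate assms(3))
qed

section \<open>The conversion\<close>

abbreviation prefix_vars :: "qbf \<Rightarrow> var list" where
  "prefix_vars \<Phi> \<equiv> concat (map snd (blocks \<Phi>))"

definition node_keys :: "qbf \<Rightarrow> 'r line list \<Rightarrow> (nat \<times> var) list" where
  "node_keys \<Phi> \<pi> = List.product [0..<length \<pi>] (univ_vars \<Phi>)"

text \<open>The filtered prefix equals \<open>[x, u]\<close> exactly if \<open>x\<close> precedes
  \<open>u\<close>, given a prefix without repetitions that contains the distinct variables
  \<open>x\<close> and \<open>u\<close>. For existential \<open>x\<close> and universal
  \<open>u\<close> this is the order of blocks, since they never share a block.\<close>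

definition t_node :: "qbf \<Rightarrow> (nat \<times> var) list \<Rightarrow> just \<Rightarrow> var \<Rightarrow> tnode" where
  "t_node \<Phi> P j u = (case j of
     Axiom k \<Rightarrow> Sink (falsifying u (nth_default [] (matrix \<Phi>) k))
   | Res a b x \<Rightarrow>
       if filter (\<lambda>v. v = x \<or> v = u) (prefix_vars \<Phi>) = [x, u]
       then IfElse x (position P (b, u)) (position P (a, u))
       else Hash (position P (a, u)) (position P (b, u)))"

text \<open>The same product as \<open>node_keys\<close> with each line index replaced by its
  justification, so the node and the key at a given position belong together.\<close>

definition t_dag :: "qbf \<Rightarrow> 'r line list \<Rightarrow> tdag" where
  "t_dag \<Phi> \<pi> = map (\<lambda>(j, u). t_node \<Phi> (node_keys \<Phi> \<pi>) j u)
     (List.product (map just \<pi>) (univ_vars \<Phi>))"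

definition t_lines :: "qbf \<Rightarrow> 'r line list \<Rightarrow> nat line list" where
  "t_lines \<Phi> \<pi> = map (\<lambda>(i, l). Line (clause l) (just l) (\<lambda>u. position (node_keys \<Phi> \<pi>) (i, u)))
     (List.enumerate 0 \<pi>)"

subsection \<open>Correctness\<close>

lemma filter_pair_eq_of_earlier:
  assumes "distinct (prefix_vars \<Phi>)" "earlier \<Phi> x u"
  shows "filter (\<lambda>v. v = x \<or> v = u) (prefix_vars \<Phi>) = [x, u]"
proof -
  obtain i j where ij: "i < j" "j < length (blocks \<Phi>)" "x \<in> set (snd (blocks \<Phi> ! i))"
    "u \<in> set (snd (blocks \<Phi> ! j))"
    using assms(2) by (auto simp: earlier_def)
  \<comment> \<open>Cut the prefix just before block \<open>j\<close>: \<open>x\<close> falls into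
    the first part and \<open>u\<close> into the second, each exactly once by distinctness.\<close>
  define as where "as = concat (map snd (take j (blocks \<Phi>)))"
  define bs where "bs = concat (map snd (drop j (blocks \<Phi>)))"
  have split: "prefix_vars \<Phi> = as @ bs"
    unfolding as_def bs_def by (metis append_take_drop_id concat_append map_append)
  have "blocks \<Phi> ! i \<in> set (take j (blocks \<Phi>))"
    using ij by (auto simp: in_set_conv_nth intro!: exI[of _ i])
  then have x: "x \<in> set as" using ij(3) by (auto simp: as_def)
  have "blocks \<Phi> ! j \<in> set (drop j (blocks \<Phi>))"
    using ij(2) by (metis Cons_nth_drop_Suc list.set_intros(1))
  then have u: "u \<in> set bs" using ij(4) by (auto simp: bs_def)
  have d: "distinct as" "distinct bs" "x \<notin> set bs" "u \<notin> set as"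
    using assms(1) x u unfolding split by auto
  have "filter (\<lambda>v. v = x \<or> v = u) as = filter (\<lambda>v. v = x) as"
    using d by (intro filter_cong) auto
  also have "\<dots> = [x]" using d(1) x by (induction as) (auto simp: filter_empty_conv)
  finally have 1: "filter (\<lambda>v. v = x \<or> v = u) as = [x]" .
  have "filter (\<lambda>v. v = x \<or> v = u) bs = filter (\<lambda>v. v = u) bs"
    using d by (intro filter_cong) auto
  also have "\<dots> = [u]" using d(2) u by (induction bs) (auto simp: filter_empty_conv)
  finally show ?thesis using 1 by (simp add: split)
qed

text \<open>Different quantifiers force different block indices. If \<open>x = u\<close>, the
  filtered prefix would be \<open>[x, x]\<close>, against distinctness.\<close>

lemma ex_univ_ordered:
  assumes "distinct (prefix_vars \<Phi>)" "x \<in> set (ex_vars \<Phi>)" "u \<in> set (univ_vars \<Phi>)"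
  shows "earlier \<Phi> x u \<or> earlier \<Phi> u x" "x \<noteq> u"
proof -
  obtain B where B: "B \<in> set (blocks \<Phi>)" "fst B = Exists" "x \<in> set (snd B)"
    using assms(2) by (auto simp: ex_vars_def)
  obtain B' where B': "B' \<in> set (blocks \<Phi>)" "fst B' = Forall" "u \<in> set (snd B')"
    using assms(3) by (auto simp: univ_vars_def)
  obtain i where i: "i < length (blocks \<Phi>)" "blocks \<Phi> ! i = B"
    using B(1) by (auto simp: in_set_conv_nth)
  obtain j where j: "j < length (blocks \<Phi>)" "blocks \<Phi> ! j = B'"
    using B'(1) by (auto simp: in_set_conv_nth)
  have "i \<noteq> j" using B(2) B'(2) i j by auto
  then show *: "earlier \<Phi> x u \<or> earlier \<Phi> u x"
    using B B' i j unfolding earlier_def by (metis linorder_neqE_nat)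
  show "x \<noteq> u"
    using * filter_pair_eq_of_earlier[OF assms(1), of x u] filter_pair_eq_of_earlier[OF assms(1), of u x]
      distinct_filter[OF assms(1), of "\<lambda>v. v = x \<or> v = u"] by auto
qed

lemma filter_pair_eq_iff_earlier:
  assumes "distinct (prefix_vars \<Phi>)" "x \<in> set (ex_vars \<Phi>)" "u \<in> set (univ_vars \<Phi>)"
  shows "filter (\<lambda>v. v = x \<or> v = u) (prefix_vars \<Phi>) = [x, u] \<longleftrightarrow> earlier \<Phi> x u"
    and "earlier \<Phi> u x \<longleftrightarrow> \<not> earlier \<Phi> x u"
proof -
  have sym: "filter (\<lambda>v. v = u \<or> v = x) (prefix_vars \<Phi>) = filter (\<lambda>v. v = x \<or> v = u) (prefix_vars \<Phi>)"
    by (rule filter_cong) auto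
  have "\<not> (earlier \<Phi> x u \<and> earlier \<Phi> u x)"
    and "earlier \<Phi> u x \<Longrightarrow> filter (\<lambda>v. v = x \<or> v = u) (prefix_vars \<Phi>) \<noteq> [x, u]"
    using filter_pair_eq_of_earlier[OF assms(1), of x u]
      filter_pair_eq_of_earlier[OF assms(1), of u x] ex_univ_ordered(2)[OF assms]
    unfolding sym by auto
  then show "filter (\<lambda>v. v = x \<or> v = u) (prefix_vars \<Phi>) = [x, u] \<longleftrightarrow> earlier \<Phi> x u"
    and "earlier \<Phi> u x \<longleftrightarrow> \<not> earlier \<Phi> x u"
    using filter_pair_eq_of_earlier[OF assms(1), of x u] ex_univ_ordered(1)[OF assms] by auto
qed

text \<open>Keys and nodes are listed row by row with \<open>length (univ_vars \<Phi>)\<close>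
  entries per line, so the quotient of a position is the line and the remainder selects the
  variable.\<close>

lemma t_dag_position:
  assumes "i < length \<pi>" "u \<in> set (univ_vars \<Phi>)"
  defines "n \<equiv> position (node_keys \<Phi> \<pi>) (i, u)"
  shows "n < length (t_dag \<Phi> \<pi>)" "n div length (univ_vars \<Phi>) = i"
    "t_dag \<Phi> \<pi> ! n = t_node \<Phi> (node_keys \<Phi> \<pi>) (just (\<pi> ! i)) u"
proof -
  let ?k = "length (univ_vars \<Phi>)"
  have "(i, u) \<in> set (node_keys \<Phi> \<pi>)" using assms by (simp add: node_keys_def)
  then have n: "n < length \<pi> * ?k" "node_keys \<Phi> \<pi> ! n = (i, u)"
    using position[of "(i, u)" "node_keys \<Phi> \<pi>"] by (simp_all add: n_def node_keys_def)
  show "n < length (t_dag \<Phi> \<pi>)" using n(1) by (simp add: t_dag_def)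
  have div: "n div ?k < length \<pi>" using n(1) by (simp add: less_mult_imp_div_less)
  then have iu: "n div ?k = i" "univ_vars \<Phi> ! (n mod ?k) = u"
    using n by (simp_all add: node_keys_def product_nth)
  then show "n div ?k = i" by simp
  show "t_dag \<Phi> \<pi> ! n = t_node \<Phi> (node_keys \<Phi> \<pi>) (just (\<pi> ! i)) u"
    using n(1) div iu by (simp add: t_dag_def product_nth)
qed

lemma position_less:
  assumes "i < length \<pi>" "u \<in> set (univ_vars \<Phi>)" "i < n div length (univ_vars \<Phi>)"
  shows "position (node_keys \<Phi> \<pi>) (i, u) < n"
  using t_dag_position(2)[OF assms(1,2)] assms(3) div_le_mono[of n _ "length (univ_vars \<Phi>)"]
  by (metis not_less)

lemma wf_t_dag:
  assumes "mres_derivation R \<Phi> \<pi>"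
  shows "wf_tdag (t_dag \<Phi> \<pi>)"
  unfolding wf_tdag_def
proof (intro allI impI ballI)
  let ?k = "length (univ_vars \<Phi>)"
  fix n p assume n: "n < length (t_dag \<Phi> \<pi>)" and p: "p \<in> children (t_dag \<Phi> \<pi> ! n)"
  have n': "n < length \<pi> * ?k" using n by (simp add: t_dag_def)
  have i: "n div ?k < length \<pi>" using n' by (simp add: less_mult_imp_div_less)
  \<comment> \<open>The existence of a node forces a universal variable to exist, so the remainder
    is a legal index.\<close>
  have "0 < ?k" using n' by (cases "?k = 0") auto
  then have u: "univ_vars \<Phi> ! (n mod ?k) \<in> set (univ_vars \<Phi>)" by simp
  have node: "t_dag \<Phi> \<pi> ! n =
      t_node \<Phi> (node_keys \<Phi> \<pi>) (just (\<pi> ! (n div ?k))) (univ_vars \<Phi> ! (n mod ?k))"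
    using n' i by (simp add: t_dag_def product_nth)
  have "valid_line R \<Phi> \<pi> (n div ?k)" using assms i by (simp add: mres_derivation_def)
  then have "a < n div ?k \<and> b < n div ?k" if "just (\<pi> ! (n div ?k)) = Res a b x" for a b x
    using that by (simp add: valid_line_def)
  moreover have "position (node_keys \<Phi> \<pi>) (a, univ_vars \<Phi> ! (n mod ?k)) < n" if "a < n div ?k" for a
    using less_trans[OF that i] u that by (rule position_less)
  ultimately show "p < n"
    using p unfolding node t_node_def
    by (auto split: just.splits if_splits)
qed

text \<open>Definedness is the delicate part: \<open>tfun\<close> fails on tests outside
  \<open>left_ex\<close> and on inconsistent \<open>Hash\<close> inputs. By induction the children
  compute exactly \<open>Ha\<close> and \<open>Hb\<close>, so the side conditions of the given
  resolution step exclude both failures.\<close>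

lemma tfun_t_dag:
  assumes "closed_qbf \<Phi>" "mres_derivation R \<Phi> \<pi>" "i < length \<pi>" "u \<in> set (univ_vars \<Phi>)"
  shows "tfun (t_dag \<Phi> \<pi>) (left_ex \<Phi> u) (position (node_keys \<Phi> \<pi>) (i, u)) =
    line_strategy R \<Phi> (\<pi> ! i) u"
  using assms(3)
proof (induction i rule: less_induct)
  case (less i)
  let ?G = "t_dag \<Phi> \<pi>" and ?V = "left_ex \<Phi> u"
  let ?n = "position (node_keys \<Phi> \<pi>) (i, u)"
  note n = t_dag_position[OF less.prems assms(4)]
  have children: "\<forall>p\<in>children (?G ! ?n). p < ?n"
    using wf_t_dag[OF assms(2)] n(1) by (simp add: wf_tdag_def)
  have valid: "valid_line R \<Phi> \<pi> i"
    using assms(2) less.prems by (simp add: mres_derivation_def)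
  have distinct: "distinct (prefix_vars \<Phi>)" using assms(1) by (simp add: closed_qbf_def)
  show ?case
  proof (cases "just (\<pi> ! i)")
    case (Axiom k)
    then have "k < length (matrix \<Phi>)" "line_strategy R \<Phi> (\<pi> ! i) u =
        Some (const_strategy ?V (falsifying u (matrix \<Phi> ! k)))"
      using valid assms(4) by (auto simp: valid_line_def)
    then show ?thesis
      using n(1,3) children Axiom
      by (subst tfun.simps) (simp add: t_node_def nth_default_def)
  next
    case (Res a b x)
    then have ab: "a < i" "b < i" and x: "x \<in> set (ex_vars \<Phi>)"
      using valid by (simp_all add: valid_line_def)
    obtain Ha Hb H where H: "line_strategy R \<Phi> (\<pi> ! a) u = Some Ha"
      "line_strategy R \<Phi> (\<pi> ! b) u = Some Hb" "line_strategy R \<Phi> (\<pi> ! i) u = Some H"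
      "earlier \<Phi> x u \<longrightarrow> H = ite_strategy ?V x Hb Ha"
      "earlier \<Phi> u x \<longrightarrow> consistent ?V Ha Hb \<and> H = union_strategy ?V Ha Hb"
      using valid Res assms(4) by (fastforce simp: valid_line_def)
    have IH: "tfun ?G ?V (position (node_keys \<Phi> \<pi>) (a, u)) = Some Ha"
      "tfun ?G ?V (position (node_keys \<Phi> \<pi>) (b, u)) = Some Hb"
      using less.IH ab less.prems H(1,2) by simp_all
    note order = filter_pair_eq_iff_earlier[OF distinct x assms(4)]
    show ?thesis
    proof (cases "earlier \<Phi> x u")
      case True
      moreover have "x \<in> ?V" using True x by (simp add: left_ex_def)
      ultimately show ?thesis
        using n(1,3) children Res H IH order
        by (subst tfun.simps) (simp add: t_node_def)
    next
      case False
      then show ?thesis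
        using n(1,3) children Res H IH order
        by (subst tfun.simps) (simp add: t_node_def)
    qed
  qed
qed

text \<open>Validity sees a representation only through the functions it denotes, and refers to no
  line beyond \<open>i\<close>.\<close>

lemma valid_line_transfer:
  assumes "valid_line R \<Phi> \<pi> i" "i < length \<pi>"
    and "\<And>j. j < length \<pi> \<Longrightarrow> clause (\<pi>' ! j) = clause (\<pi> ! j)"
    and "\<And>j. j < length \<pi> \<Longrightarrow> just (\<pi>' ! j) = just (\<pi> ! j)"
    and "\<And>j u. j < length \<pi> \<Longrightarrow> u \<in> set (univ_vars \<Phi>) \<Longrightarrow>
      line_strategy R' \<Phi> (\<pi>' ! j) u = line_strategy R \<Phi> (\<pi> ! j) u"
  shows "valid_line R' \<Phi> \<pi>' i"
  using assms by (auto simp: valid_line_def split: just.splits)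

theorem mres_T_refutation_conversion:
  assumes "closed_qbf \<Phi>" "mres_refutation R \<Phi> \<pi>"
  shows "mres_T_refutation \<Phi> (t_dag \<Phi> \<pi>, t_lines \<Phi> \<pi>)"
proof -
  have der: "mres_derivation R \<Phi> \<pi>" using assms(2) by (simp add: mres_refutation_def)
  let ?G = "t_dag \<Phi> \<pi>" and ?ls = "t_lines \<Phi> \<pi>"
  let ?\<pi> = "map (map_line (Pair ?G)) ?ls"
  have len: "length ?ls = length \<pi>" by (simp add: t_lines_def)
  have ls: "?ls ! i = Line (clause (\<pi> ! i)) (just (\<pi> ! i)) (\<lambda>u. position (node_keys \<Phi> \<pi>) (i, u))"
    if "i < length \<pi>" for i
    using that by (simp add: t_lines_def nth_enumerate_eq)
  have line: "?\<pi> ! i = Line (clause (\<pi> ! i)) (just (\<pi> ! i))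
      (\<lambda>u. (?G, position (node_keys \<Phi> \<pi>) (i, u)))" if "i < length \<pi>" for i
    using that by (simp add: ls len comp_def)
  have strategy: "line_strategy T_rep \<Phi> (?\<pi> ! i) u = line_strategy R \<Phi> (\<pi> ! i) u"
    if "i < length \<pi>" "u \<in> set (univ_vars \<Phi>)" for i u
    using tfun_t_dag[OF assms(1) der that] wf_t_dag[OF der] that
    by (simp add: line line_strategy_def T_rep_def)
  have "valid_line T_rep \<Phi> ?\<pi> i" if "i < length \<pi>" for i
    by (rule valid_line_transfer[of R \<Phi> \<pi> i])
      (use der that strategy in \<open>simp_all add: mres_derivation_def line\<close>)
  then have "mres_derivation T_rep \<Phi> ?\<pi>" by (simp add: mres_derivation_def len)
  moreover have \<pi>: "\<pi> \<noteq> []" "clause (last \<pi>) = []"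
    using assms(2) by (simp_all add: mres_refutation_def)
  moreover have "?ls \<noteq> []" using \<pi>(1) len by auto
  moreover from this have "clause (last ?\<pi>) = []"
    using \<pi> by (simp add: last_map last_conv_nth len ls)
  \<comment> \<open>Agreement of functions does not determine the graph; here the prescribed shape
    of each node is checked as well.\<close>
  moreover have "t_nodes \<Phi> (?G, ?ls)"
    unfolding t_nodes_def prod.case
  proof (intro allI impI ballI)
    fix i u assume "i < length ?ls" and u: "u \<in> set (univ_vars \<Phi>)"
    then have i: "i < length \<pi>" by (simp add: len)
    have valid: "valid_line R \<Phi> \<pi> i" using der i by (simp add: mres_derivation_def)
    have distinct: "distinct (prefix_vars \<Phi>)" using assms(1) by (simp add: closed_qbf_def)
    note node = t_dag_position[OF i u]
    show "strat (?ls ! i) u < length ?G \<and>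
       (case just (?ls ! i) of
          Axiom k \<Rightarrow> ?G ! strat (?ls ! i) u = Sink (falsifying u (matrix \<Phi> ! k))
        | Res a b x \<Rightarrow>
            (earlier \<Phi> x u \<longrightarrow>
               ?G ! strat (?ls ! i) u = IfElse x (strat (?ls ! b) u) (strat (?ls ! a) u)) \<and>
            (earlier \<Phi> u x \<longrightarrow>
               ?G ! strat (?ls ! i) u = Hash (strat (?ls ! a) u) (strat (?ls ! b) u)))"
    proof (cases "just (\<pi> ! i)")
      case (Axiom k)
      then show ?thesis
        using valid node i by (simp add: ls valid_line_def t_node_def nth_default_def)
    next
      case (Res a b x)
      then have "a < length \<pi>" "b < length \<pi>" "x \<in> set (ex_vars \<Phi>)"
        using valid i by (simp_all add: valid_line_def)
      then show ?thesis
        using node i Res filter_pair_eq_iff_earlier[OF distinct _ u] by (simp add: ls t_node_def)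
    qed
  qed
  ultimately show ?thesis
    using wf_t_dag[OF der] by (simp add: mres_T_refutation_def mres_refutation_def)
qed

lemma map_clause_t_lines: "map clause (t_lines \<Phi> \<pi>) = map clause \<pi>"
proof -
  have "map clause (t_lines \<Phi> \<pi>) = map clause (map snd (List.enumerate 0 \<pi>))"
    unfolding t_lines_def map_map by (rule map_cong) auto
  then show ?thesis by simp
qed

subsection \<open>Running time\<close>

lemma enc_list_map: "enc_list f (map g xs) = enc_list (\<lambda>x. f (g x)) xs"
  by (induction xs) auto

lemma enumerate_map: "List.enumerate n (map f xs) = map (\<lambda>p. (fst p, f (snd p))) (List.enumerate n xs)"
  by (induction xs arbitrary: n) auto

text \<open>Replaces the case distinction on justifications by a Boolean tag and total field
  selectors, which return 0 on the wrong constructor.\<close>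

lemma polytime_just:
  assumes "polytime e (\<lambda>i. enc_just (j i))"
  shows "polytime e (\<lambda>i. enc_bool (case j i of Axiom k \<Rightarrow> False | Res a b x \<Rightarrow> True))"
    and "polytime e (\<lambda>i. enc_nat (case j i of Axiom k \<Rightarrow> k | Res a b x \<Rightarrow> 0))"
    and "polytime e (\<lambda>i. enc_nat (case j i of Axiom k \<Rightarrow> 0 | Res a b x \<Rightarrow> a))"
    and "polytime e (\<lambda>i. enc_nat (case j i of Axiom k \<Rightarrow> 0 | Res a b x \<Rightarrow> b))"
    and "polytime e (\<lambda>i. enc_nat (case j i of Axiom k \<Rightarrow> 0 | Res a b x \<Rightarrow> x))"
proof -
  let ?res = "\<lambda>i. case j i of Axiom k \<Rightarrow> False | Res a b x \<Rightarrow> True"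
  show res: "polytime e (\<lambda>i. enc_bool (?res i))"
    using polytime_hd[OF assms]
    by (rule back_subst[of "polytime e"]) (auto simp: fun_eq_iff split: just.split)
  show "polytime e (\<lambda>i. enc_nat (case j i of Axiom k \<Rightarrow> k | Res a b x \<Rightarrow> 0))"
    using polytime_if[OF res polytime_Leaf polytime_tl[OF assms]]
    by (rule back_subst[of "polytime e"])
      (auto simp: fun_eq_iff enc_nat.simps[of 0] split: just.split)
  show "polytime e (\<lambda>i. enc_nat (case j i of Axiom k \<Rightarrow> 0 | Res a b x \<Rightarrow> a))"
    using polytime_if[OF res polytime_hd[OF polytime_tl[OF assms]] polytime_Leaf]
    by (rule back_subst[of "polytime e"])
      (auto simp: fun_eq_iff enc_nat.simps[of 0] split: just.split)
  show "polytime e (\<lambda>i. enc_nat (case j i of Axiom k \<Rightarrow> 0 | Res a b x \<Rightarrow> b))"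
    using polytime_if[OF res polytime_hd[OF polytime_tl[OF polytime_tl[OF assms]]] polytime_Leaf]
    by (rule back_subst[of "polytime e"])
      (auto simp: fun_eq_iff enc_nat.simps[of 0] split: just.split)
  show "polytime e (\<lambda>i. enc_nat (case j i of Axiom k \<Rightarrow> 0 | Res a b x \<Rightarrow> x))"
    using polytime_if[OF res polytime_tl[OF polytime_tl[OF polytime_tl[OF assms]]] polytime_Leaf]
    by (rule back_subst[of "polytime e"])
      (auto simp: fun_eq_iff enc_nat.simps[of 0] split: just.split)
qed

lemma inj_enc_lit: "inj enc_lit"
proof (rule injI)
  fix l l' assume "enc_lit l = enc_lit l'"
  then show "l = l'"
    by (cases l; cases l') (auto simp: enc_bool_def dest: injD[OF inj_enc_nat])
qed

lemma polytime_falsifying: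
  assumes "polytime e (\<lambda>i. enc_nat (u i))" "polytime e (\<lambda>i. enc_clause (C i))"
  shows "polytime e (\<lambda>i. enc_tri (falsifying (u i) (C i)))"
proof -
  have lit: "polytime e (\<lambda>i. enc_lit (Pos (u i)))" "polytime e (\<lambda>i. enc_lit (Neg (u i)))"
    by (simp_all add: polytime_Node polytime_True polytime_False assms(1))
  have "polytime e (\<lambda>i. if Pos (u i) \<in> set (C i) then enc_nat 0
      else if Neg (u i) \<in> set (C i) then enc_nat (Suc 0) else enc_nat (Suc (Suc 0)))"
    using assms(2) unfolding enc_clause_def
    by (intro polytime_if polytime_mem[where ea = enc_lit] polytime_Suc polytime_0 lit inj_enc_lit)
  then show ?thesis
    by (rule back_subst[of "polytime e"]) (auto simp: falsifying_def fun_eq_iff numeral_2_eq_2)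
qed

text \<open>Stated for an arbitrary \<open>e\<close> because it is used under a map, where prefix,
  matrix and keys come from the outer instance while \<open>j\<close> and \<open>u\<close> come from
  the current element.\<close>

lemma polytime_t_node:
  assumes vars: "polytime e (\<lambda>i. enc_list enc_nat (prefix_vars (\<Phi> i)))"
    and matrix: "polytime e (\<lambda>i. enc_list enc_clause (matrix (\<Phi> i)))"
    and P: "polytime e (\<lambda>i. enc_list (enc_pair enc_nat enc_nat) (P i))"
    and j: "polytime e (\<lambda>i. enc_just (j i))"
    and u: "polytime e (\<lambda>i. enc_nat (u i))"
  shows "polytime e (\<lambda>i. enc_tnode (t_node (\<Phi> i) (P i) (j i) (u i)))"
proof -
  let ?res = "\<lambda>i. case j i of Axiom k \<Rightarrow> False | Res a b x \<Rightarrow> True"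
  define k where "k i = (case j i of Axiom k \<Rightarrow> k | Res a b x \<Rightarrow> 0)" for i
  define a where "a i = (case j i of Axiom k \<Rightarrow> 0 | Res a b x \<Rightarrow> a)" for i
  define b where "b i = (case j i of Axiom k \<Rightarrow> 0 | Res a b x \<Rightarrow> b)" for i
  define x where "x i = (case j i of Axiom k \<Rightarrow> 0 | Res a b x \<Rightarrow> x)" for i
  note just = polytime_just[OF j, folded k_def a_def b_def x_def]
  have inj: "inj (enc_pair enc_nat enc_nat)" "inj (enc_list enc_nat)"
    by (intro inj_enc_pair inj_enc_list inj_enc_nat)+
  have clause: "polytime e (\<lambda>i. enc_clause (nth_default [] (matrix (\<Phi> i)) (k i)))"
    by (intro polytime_nth_default just matrix) (simp add: enc_clause_def)
  have pos: "polytime e (\<lambda>i. enc_nat (position (P i) (a i, u i)))"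
    "polytime e (\<lambda>i. enc_nat (position (P i) (b i, u i)))"
    by (intro polytime_position[OF polytime_Pair P inj(1)] just u)+
  have ord: "polytime e (\<lambda>i. enc_bool (filter (\<lambda>v. v = x i \<or> v = u i) (prefix_vars (\<Phi> i)) = [x i, u i]))"
    by (intro polytime_eq[where g = "enc_list enc_nat"] polytime_filter polytime_disj vars
        polytime_eq[where g = enc_nat] polytime_snd_context
        polytime_fst_context[OF just(5)] polytime_fst_context[OF u]
        polytime_Cons polytime_Nil just u inj inj_enc_nat)
  have "polytime e (\<lambda>i. if ?res i then
        if filter (\<lambda>v. v = x i \<or> v = u i) (prefix_vars (\<Phi> i)) = [x i, u i]
        then Node (enc_nat (Suc 0)) (Node (enc_nat (x i))
          (Node (enc_nat (position (P i) (b i, u i))) (enc_nat (position (P i) (a i, u i)))))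
        else Node (enc_nat (Suc (Suc 0)))
          (Node (enc_nat (position (P i) (a i, u i))) (enc_nat (position (P i) (b i, u i))))
      else Node (enc_nat 0) (enc_tri (falsifying (u i) (nth_default [] (matrix (\<Phi> i)) (k i)))))"
    by (intro polytime_if just ord polytime_Node polytime_Suc polytime_0 pos
        polytime_falsifying u clause)
  then show ?thesis
    by (rule back_subst[of "polytime e"])
      (auto simp: fun_eq_iff t_node_def k_def a_def b_def x_def numeral_2_eq_2 split: just.split)
qed

theorem polytime_conversion:
  "polytime enc_instance (\<lambda>(\<Phi>, \<pi>). enc_T_refutation \<Phi> (t_dag \<Phi> \<pi>, t_lines \<Phi> \<pi>))"
proof -
  let ?e = enc_instance
  \<comment> \<open>The quantifier is coded by its test against \<open>Exists\<close>, so the code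
    of a block is an \<open>enc_pair\<close> and the projection rules reach all parts of the
    instance.\<close>
  let ?block = "enc_pair (\<lambda>q. enc_bool (q = Exists)) (enc_list enc_nat)"
  define key where "key i = node_keys (fst i) (snd i)" for i :: "qbf \<times> bool list line list"
  have e: "?e = (\<lambda>i. Node (Node (enc_list ?block (blocks (fst i)))
      (enc_list enc_clause (matrix (fst i))))
      (enc_list (enc_line (enc_list enc_bool) (fst i)) (snd i)))"
    by (auto simp: fun_eq_iff enc_instance_def enc_qbf_def enc_pair_def case_prod_beta'
        intro!: arg_cong[where f = "\<lambda>f. enc_list f _"])
  have blocks: "polytime ?e (\<lambda>i. enc_list ?block (blocks (fst i)))"
    using polytime_hd[OF polytime_hd[OF polytime_refl[of ?e]]] by (simp add: e)
  have matrix: "polytime ?e (\<lambda>i. enc_list enc_clause (matrix (fst i)))"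
    using polytime_tl[OF polytime_hd[OF polytime_refl[of ?e]]] by (simp add: e)
  have lines: "polytime ?e (\<lambda>i. enc_list (enc_line (enc_list enc_bool) (fst i)) (snd i))"
    using polytime_tl[OF polytime_refl[of ?e]] by (simp add: e)
  have vars: "polytime ?e (\<lambda>i. enc_list enc_nat (prefix_vars (fst i)))"
    by (intro polytime_concat polytime_map[OF blocks] polytime_snd[OF polytime_snd_context])
  have "polytime (\<lambda>p. Node (?e (fst p)) (?block (snd p))) (\<lambda>p. enc_bool (fst (snd p) = Exists))"
    by (rule polytime_fst[OF polytime_snd_context])
  from polytime_not[OF this]
  have "polytime (\<lambda>p. Node (?e (fst p)) (?block (snd p))) (\<lambda>p. enc_bool (fst (snd p) = Forall))"
    by (rule back_subst[of "polytime _"])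
      (auto simp: fun_eq_iff intro!: arg_cong[where f = enc_bool] intro: quant.exhaust)
  then have univ: "polytime ?e (\<lambda>i. enc_list enc_nat (univ_vars (fst i)))"
    unfolding univ_vars_def
    by (intro polytime_concat polytime_map[OF polytime_filter[OF blocks]]
        polytime_snd[OF polytime_snd_context])
  \<comment> \<open>Only the clause and the justification are projected out of a line. The code of a
    line depends on the formula, which fixes how many strategies are listed.\<close>
  have "polytime (\<lambda>p. Node (?e (fst p)) (enc_line (enc_list enc_bool) (fst (fst p)) (snd p)))
      (\<lambda>p. enc_pair enc_clause enc_just (clause (snd p), just (snd p)))"
  proof (rule polytime_Pair)
    let ?e' = "\<lambda>p. Node (?e (fst p)) (enc_line (enc_list enc_bool) (fst (fst p)) (snd p))"
    have *: "polytime ?e' (\<lambda>p. enc_line (enc_list enc_bool) (fst (fst p)) (snd p))"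
      by (rule polytime_snd_context)
    show "polytime ?e' (\<lambda>p. enc_clause (clause (snd p)))"
      using polytime_hd[OF *] by (simp add: enc_line_def)
    show "polytime ?e' (\<lambda>p. enc_just (just (snd p)))"
      using polytime_hd[OF polytime_tl[OF *]] by (simp add: enc_line_def)
  qed
  from polytime_map[where ea = "\<lambda>i. enc_line (enc_list enc_bool) (fst i)"
      and g = "\<lambda>_ l. (clause l, just l)", OF lines this]
  have cj: "polytime ?e (\<lambda>i. enc_list (enc_pair enc_clause enc_just)
      (map (\<lambda>l. (clause l, just l)) (snd i)))" .
  have "polytime ?e (\<lambda>i. enc_list enc_just (map snd (map (\<lambda>l. (clause l, just l)) (snd i))))"
    by (intro polytime_map[OF cj] polytime_snd[OF polytime_snd_context])
  then have justs: "polytime ?e (\<lambda>i. enc_list enc_just (map just (snd i)))"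
    by (simp add: comp_def)
  \<comment> \<open>The line indices are the first components of an enumeration, which saves a
    counting loop.\<close>
  have "polytime ?e (\<lambda>i. enc_list enc_nat (map fst (List.enumerate 0 (map just (snd i)))))"
    by (intro polytime_map[OF polytime_enumerate[OF justs]] polytime_fst[OF polytime_snd_context])
  then have keys: "polytime ?e (\<lambda>i. enc_list (enc_pair enc_nat enc_nat) (key i))"
    unfolding key_def node_keys_def using univ by (intro polytime_product) simp_all
  have dag: "polytime ?e (\<lambda>i. enc_list enc_tnode (t_dag (fst i) (snd i)))"
  proof -
    let ?e' = "\<lambda>p. Node (?e (fst p)) (enc_pair enc_just enc_nat (snd p))"
    have "polytime ?e' (\<lambda>p. enc_tnode (t_node (fst (fst p)) (key (fst p)) (fst (snd p)) (snd (snd p))))"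
      by (intro polytime_t_node polytime_fst[OF polytime_snd_context]
          polytime_snd[OF polytime_snd_context] polytime_fst_context[OF vars]
          polytime_fst_context[OF matrix] polytime_fst_context[OF keys])
    from polytime_map[where ea = "\<lambda>_. enc_pair enc_just enc_nat" and eb = enc_tnode
        and g = "\<lambda>i q. t_node (fst i) (key i) (fst q) (snd q)",
        OF polytime_product[OF justs univ] this]
    show ?thesis by (simp add: t_dag_def key_def case_prod_beta')
  qed
  have lines': "polytime ?e (\<lambda>i. enc_list (enc_line enc_nat (fst i)) (t_lines (fst i) (snd i)))"
  proof -
    let ?cj = "enc_pair enc_nat (enc_pair enc_clause enc_just)"
    let ?e' = "\<lambda>p. Node (?e (fst p)) (?cj (snd p))"
    have q: "polytime ?e' (\<lambda>p. ?cj (snd p))" by (rule polytime_snd_context)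
    have "polytime (\<lambda>r. Node (?e' (fst r)) (enc_nat (snd r)))
        (\<lambda>r. enc_nat (position (key (fst (fst r))) (fst (snd (fst r)), snd r)))"
      by (intro polytime_position[where f = "enc_pair enc_nat enc_nat"] polytime_Pair
          polytime_snd_context polytime_fst_context[OF polytime_fst[OF q]]
          polytime_fst_context[OF polytime_fst_context[OF keys]] inj_enc_pair inj_enc_nat)
    from polytime_map[where ea = "\<lambda>_. enc_nat" and eb = enc_nat
        and g = "\<lambda>p u. position (key (fst p)) (fst (snd p), u)",
        OF polytime_fst_context[OF univ] this]
    have "polytime ?e' (\<lambda>p. Node (enc_clause (fst (snd (snd p)))) (Node (enc_just (snd (snd (snd p))))
        (enc_list enc_nat (map (\<lambda>u. position (key (fst p)) (fst (snd p), u)) (univ_vars (fst (fst p)))))))"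
      by (intro polytime_Node polytime_fst[OF polytime_snd[OF q]] polytime_snd[OF polytime_snd[OF q]])
    \<comment> \<open>Each output line is built directly as a tree, so the result encoding is the
      identity; the function \<open>strat\<close> appears only through its values at the universal
      variables.\<close>
    from polytime_map[where ea = "\<lambda>_. ?cj" and eb = "\<lambda>d. d" and
        g = "\<lambda>i q. Node (enc_clause (fst (snd q))) (Node (enc_just (snd (snd q)))
          (enc_list enc_nat (map (\<lambda>u. position (key i) (fst q, u)) (univ_vars (fst i)))))",
        OF polytime_enumerate[OF cj] this]
    show ?thesis
      by (simp add: t_lines_def key_def enc_list_map enc_line_def case_prod_beta'
          enumerate_map)
  qed
  show ?thesis
    using polytime_Node[OF dag lines'] by (simp add: enc_T_refutation_def case_prod_beta')
qed

theorem theorem8: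
  fixes R :: "bool list representation"
  assumes "complete_representation R"
  shows "\<exists>F :: qbf \<Rightarrow> bool list line list \<Rightarrow> t_refutation.
    (\<forall>\<Phi> \<pi>. closed_qbf \<Phi> \<and> \<not> true_qbf \<Phi> \<and> mres_refutation R \<Phi> \<pi> \<longrightarrow>
       mres_T_refutation \<Phi> (F \<Phi> \<pi>) \<and> map clause (snd (F \<Phi> \<pi>)) = map clause \<pi>) \<and>
    poly_time_on {(\<Phi>, \<pi>). closed_qbf \<Phi> \<and> \<not> true_qbf \<Phi> \<and> mres_refutation R \<Phi> \<pi>}
      enc_instance (\<lambda>(\<Phi>, \<pi>). enc_T_refutation \<Phi> (F \<Phi> \<pi>))"
  by (rule exI[of _ "\<lambda>\<Phi> \<pi>. (t_dag \<Phi> \<pi>, t_lines \<Phi> \<pi>)"])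
    (auto simp: map_clause_t_lines polytime_imp_poly_time_on[OF polytime_conversion]
      intro: mres_T_refutation_conversion)

end
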